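(* Let $\widehat A=A+\varepsilon A_0\in\mathbb{DC}_z^{n\times n}$, and for $i=1,\dots,n$ let $\widehat x_i=x_i+\varepsilon\widetilde x_i,\ \widehat y_i=y_i+\varepsilon\widetilde y_i$ be nonzero dual complex vectors of length $r_i$. Let $\widehat B=B+\varepsilon B_0=\mathrm{diag}(\widehat x_1^T,\dots,\widehat x_n^T)$ (an $n\times\sum_i r_i$ block-diagonal matrix), $\widehat C=C+\varepsilon C_0=\mathrm{diag}(\widehat y_1,\dots,\widehat y_n)$, and $$\widehat M=\begin{pmatrix}\widehat A&\widehat B\\ \widehat C&O\end{pmatrix}\in\mathbb{DC}_z^{(n+\sum_i r_i)\times(n+\sum_i r_i)}$$ (the adjacency matrix of a DN-DLS digraph $DWgls(D,r_1,\dots,r_n)$). If $x_i^Ty_i+\varepsilon(x_i^T\widetilde y_i+\widetilde x_i^Ty_i)=0$ for all $i=1,\dots,n$ and $\mathrm{Ind}_s(\widehat A)=k$, then $\widehat M^D=M^D+\varepsilon M_0$ equals $$\begin{pmatrix}A^D&A^{2D}B\\ CA^{2D}&CA^{3D}B\end{pmatrix}+\varepsilon\begin{pmatrix}A_R&A^{2D}B_0+A^DA_RB+A_RA^DB\\ CA^DA_R+CA_RA^D+C_0A^{2D}&CA^{3D}B_0+CA^{2D}A_RB+C_0A^{3D}B+CA^DA_RA^DB+CA_RA^{2D}B\end{pmatrix},$$ where $A_R=-A^DA_0A^D+\sum_{i=0}^{k-1}(A^D)^{i+2}A_0A^i(I_n-AA^D)+\sum_{i=0}^{k-1}(I_n-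AA^D)A^iA_0(A^D)^{i+2}$.
   Context: Dual numbers: $\varepsilon\neq0$, $\varepsilon^2=0$, commuting with complex matrices; a dual complex matrix is $\widehat{A}=A+\varepsilon A_0$ with complex standard part $A$ and infinitesimal part $A_0$. For complex square $A$, $\mathrm{Ind}(A)$ is the least $k\ge0$ with $\operatorname{rank}A^k=\operatorname{rank}A^{k+1}$ and $A^D$ its Drazin inverse; $A^{sD}=(A^D)^s$. $\mathbb{DC}_z^{N\times N}$ is the set of $\widehat{A}=A+\varepsilon A_0$ with $(I-AA^D)\big(\sum_{i=1}^{k}A^{k-i}A_0A^{i-1}\big)(I-AA^D)=O$, $k=\mathrm{Ind}(A)$. For such $\widehat A$ the dual Drazin inverse $\widehat A^D$ is the unique $\widehat X$ with $\widehat A^k\widehat X\widehat A=\widehat A^k$, $\widehat X\widehat A\widehat X=\widehat X$, $\widehat A\widehat X=\widehat X\widehat A$; it equals $A^D+\varepsilon A_R$ with $A_R$ as in the claim. $\mathrm{Ind}_s(\widehat A):=\mathrm{Ind}(A)$. *)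

theory Defs
  imports Complex_Main "Jordan_Normal_Form.DL_Rank"
begin

section \<open>Dual complex numbers\<close>

text \<open>\<open>Dual a b\<close> is the dual number \<open>a + \<epsilon> b\<close>.\<close>

datatype dual_complex = Dual (std_part: complex) (inf_part: complex)

instantiation dual_complex :: comm_ring_1
begin

definition zero_dual_complex :: dual_complex where "0 = Dual 0 0"

definition one_dual_complex :: dual_complex where "1 = Dual 1 0"

definition plus_dual_complex :: "dual_complex \<Rightarrow> dual_complex \<Rightarrow> dual_complex" where
  "p + q = Dual (std_part p + std_part q) (inf_part p + inf_part q)"

definition minus_dual_complex :: "dual_complex \<Rightarrow> dual_complex \<Rightarrow> dual_complex" where
  "p - q = Dual (std_part p - std_part q) (inf_part p - inf_part q)"

definition uminus_dual_complex :: "dual_complex \<Rightarrow> dual_complex" where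
  "- p = Dual (- std_part p) (- inf_part p)"

definition times_dual_complex :: "dual_complex \<Rightarrow> dual_complex \<Rightarrow> dual_complex" where
  "p * q = Dual (std_part p * std_part q) (std_part p * inf_part q + inf_part p * std_part q)"

instance
  by standard
    (auto simp: zero_dual_complex_def one_dual_complex_def plus_dual_complex_def
      minus_dual_complex_def uminus_dual_complex_def times_dual_complex_def
      dual_complex.expand algebra_simps)

end

definition dual_of :: "complex \<Rightarrow> dual_complex" where
  "dual_of z = Dual z 0"

definition eps :: dual_complex where
  "eps = Dual 0 1"

lemma Dual_eq: "Dual a b = dual_of a + eps * dual_of b"
  by (simp add: dual_of_def eps_def plus_dual_complex_def times_dual_complex_def)

lemma eps_nonzero: "eps \<noteq> 0"
  by (simp add: eps_def zero_dual_complex_def)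

lemma eps_square: "eps * eps = 0"
  by (simp add: eps_def times_dual_complex_def zero_dual_complex_def)


section \<open>Dual complex vectors and matrices\<close>

definition dual_vec :: "complex vec \<Rightarrow> complex vec \<Rightarrow> dual_complex vec" where
  "dual_vec x x' = map_vec dual_of x + eps \<cdot>\<^sub>v map_vec dual_of x'"

definition dual_mat :: "complex mat \<Rightarrow> complex mat \<Rightarrow> dual_complex mat" where
  "dual_mat A A\<^sub>0 = map_mat dual_of A + eps \<cdot>\<^sub>m map_mat dual_of A\<^sub>0"

definition std_mat :: "dual_complex mat \<Rightarrow> complex mat" where
  "std_mat = map_mat std_part"

definition inf_mat :: "dual_complex mat \<Rightarrow> complex mat" where
  "inf_mat = map_mat inf_part"

lemma dual_mat_std_inf: "dual_mat (std_mat Ah) (inf_mat Ah) = Ah"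
  by (rule eq_matI) (simp_all add: dual_mat_def std_mat_def inf_mat_def flip: Dual_eq)


section \<open>Index and Drazin inverse\<close>

text \<open>The definitions below are meant for square matrices.\<close>

definition mat_Ind :: "complex mat \<Rightarrow> nat" where
  "mat_Ind A = (LEAST k. vec_space.rank (dim_row A) (A ^\<^sub>m k)
                       = vec_space.rank (dim_row A) (A ^\<^sub>m (k + 1)))"

text \<open>The defining equations of the Drazin inverse, for the exponent \<open>k\<close>; used both for
  complex and for dual complex matrices.\<close>

definition is_drazin :: "nat \<Rightarrow> 'a :: comm_ring_1 mat \<Rightarrow> 'a mat \<Rightarrow> bool" where
  "is_drazin k A X \<longleftrightarrow> X \<in> carrier_mat (dim_row A) (dim_row A) \<and>
     A ^\<^sub>m k * X * A = A ^\<^sub>m k \<and> X * A * X = X \<and> A * X = X * A"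

definition drazin_inv :: "complex mat \<Rightarrow> complex mat" where
  "drazin_inv A = (THE X. is_drazin (mat_Ind A) A X)"

definition Ind_s :: "dual_complex mat \<Rightarrow> nat" where
  "Ind_s Ah = mat_Ind (std_mat Ah)"

definition dual_drazin_inv :: "dual_complex mat \<Rightarrow> dual_complex mat" where
  "dual_drazin_inv Ah = (THE X. is_drazin (Ind_s Ah) Ah X)"

text \<open>Sums of complex \<open>N \<times> N\<close> matrices; the library has no addition class instance
  for matrices, since the zero matrix depends on the dimension.\<close>

abbreviation msum :: "nat \<Rightarrow> (nat \<Rightarrow> complex mat) \<Rightarrow> nat set \<Rightarrow> complex mat" where
  "msum N \<equiv> finsum (module_mat TYPE(complex) N N)"

definition DC_z :: "nat \<Rightarrow> dual_complex mat set" where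
  "DC_z N = {Ah \<in> carrier_mat N N.
     let A = std_mat Ah; A\<^sub>0 = inf_mat Ah; k = mat_Ind A; P = 1\<^sub>m N - A * drazin_inv A
     in P * msum N (\<lambda>i. A ^\<^sub>m (k - i) * A\<^sub>0 * A ^\<^sub>m (i - 1)) {1..k} * P = 0\<^sub>m N N}"

end

theory Submission
  imports Defs
begin

text \<open>
Over any commutative ring, if \<open>B C = 0\<close> then
\<open>(X, X\<^sup>2 B; C X\<^sup>2, C X\<^sup>3 B)\<close> satisfies the Drazin equations for the bordered matrix
\<open>(A, B; C, 0)\<close>, with exponent \<open>k + 2\<close>, as soon as \<open>X\<close> satisfies them for \<open>A\<close> with
exponent \<open>k\<close>. The orthogonality hypothesis says precisely that \<open>B C = 0\<close> over the dual
numbers, so this applies both to the standard parts and to the dual matrices; separating the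
infinitesimal part of the dual block matrix gives the stated formula.

Solutions of the Drazin equations for different exponents coincide, so it does not matter that
\<open>k + 2\<close> need not be the index of the bordered matrix, provided a solution with the index as
exponent exists. In the complex case it comes from the stabilisation of the ranks of the powers of
the matrix and of its transpose, which yields \<open>A\<^sup>m = A\<^sup>m\<^sup>+\<^sup>1 Z = W A\<^sup>m\<^sup>+\<^sup>1\<close>. In the dual case put
\<open>P = I - A D\<close>; the sum \<open>U\<close> of the terms \<open>D\<^sup>i\<^sup>+\<^sup>2 A\<^sub>0 A\<^sup>i P\<close> telescopes to \<open>A U = D A\<^sub>0 P + U A\<close>, hence
\<open>A\<^sup>k U = D S P\<close> where \<open>S\<close> is the infinitesimal part of the \<open>k\<close>-th power of the dual matrix, and
\<open>P S P = 0\<close> is what is needed to conclude.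
\<close>

section \<open>Rank and divisibility\<close>

context vec_space
begin

text \<open>Reduces span membership to solvability of a linear system, so that factorisations of
  matrices can be built column by column.\<close>

lemma span_cols_iff:
  assumes A: "A \<in> carrier_mat n nc"
  shows "v \<in> span (set (cols A)) \<longleftrightarrow> (\<exists>w \<in> carrier_vec nc. v = A *\<^sub>v w)"
proof -
  have sub: "set (cols A) \<subseteq> carrier_vec n"
    using A cols_dim by blast
  have dims: "\<forall>w \<in> set (cols A). dim_vec w = n"
    using sub by auto
  have len: "length (cols A) = nc" and mat: "mat_of_cols n (cols A) = A"
    using A by auto
  have lin: "lincomb_list c (cols A) = A *\<^sub>v vec nc c" for c
    using lincomb_list_as_mat_mult[OF dims] len mat by simp
  have "v \<in> span (set (cols A)) \<longleftrightarrow> (\<exists>c. v = A *\<^sub>v vec nc c)"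
    unfolding span_list_as_span[OF sub, symmetric] span_list_def lin by auto
  also have "\<dots> \<longleftrightarrow> (\<exists>w \<in> carrier_vec nc. v = A *\<^sub>v w)"
  proof
    assume "\<exists>w \<in> carrier_vec nc. v = A *\<^sub>v w"
    then obtain w where "w \<in> carrier_vec nc" "v = A *\<^sub>v w" by blast
    moreover from this have "vec nc (($) w) = w" by auto
    ultimately show "\<exists>c. v = A *\<^sub>v vec nc c" by metis
  qed auto
  finally show ?thesis .
qed

lemma span_cols_mult_subset:
  assumes A: "A \<in> carrier_mat n m" and B: "B \<in> carrier_mat m nc"
  shows "span (set (cols (A * B))) \<subseteq> span (set (cols A))"
proof
  fix v assume "v \<in> span (set (cols (A * B)))"
  then obtain w where w: "w \<in> carrier_vec nc" "v = (A * B) *\<^sub>v w"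
    using span_cols_iff[of "A * B" nc v] A B by auto
  then have "v = A *\<^sub>v (B *\<^sub>v w)" "B *\<^sub>v w \<in> carrier_vec m"
    using A B by auto
  then show "v \<in> span (set (cols A))"
    unfolding span_cols_iff[OF A] by blast
qed

text \<open>Dimensions are compared inside the column space of \<open>A\<close>, so the smaller
  column space has to be a subspace of that space and not only of the ambient one.\<close>

lemma span_cols_mult_subspace:
  assumes A: "A \<in> carrier_mat n m" and B: "B \<in> carrier_mat m nc"
  shows "subspace class_ring (span (set (cols (A * B)))) (span_vs (set (cols A)))"
proof (rule nested_subspaces[OF _ _ span_cols_mult_subset[OF A B]])
  show "subspace class_ring (span (set (cols A))) V"
    by (rule span_is_subspace) (use A cols_dim[of A] in auto)
  show "subspace class_ring (span (set (cols (A * B)))) V"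
    by (rule span_is_subspace) (use A B cols_dim[of "A * B"] in auto)
qed

lemma rank_mult_le:
  assumes A: "A \<in> carrier_mat n m" and B: "B \<in> carrier_mat m nc"
  shows "rank (A * B) \<le> rank A"
proof -
  have vs: "vectorspace class_ring (span_vs (set (cols A)))"
    by (rule subspace_is_vs, rule span_is_subspace) (use A cols_dim[of A] in auto)
  show ?thesis
    unfolding rank_def
    using vectorspace.subspace_dim[OF vs span_cols_mult_subspace[OF A B] fin_dim_span_cols[OF A]]
      fin_dim_span_cols[of "A * B" nc] A B by auto
qed

text \<open>Of the two nested column spaces neither can be larger when the ranks agree. Hence every
  column of \<open>A\<close> is a combination of columns of \<open>A * B\<close>, and the
  coefficient vectors form the columns of \<open>Z\<close>.\<close>

lemma rank_mult_eq_imp_factor: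
  assumes A: "A \<in> carrier_mat n m" and B: "B \<in> carrier_mat m nc"
    and rank: "rank (A * B) = rank A"
  shows "\<exists>Z \<in> carrier_mat nc m. A = A * B * Z"
proof -
  let ?W = "span (set (cols A))" and ?X = "span (set (cols (A * B)))"
  have AB: "A * B \<in> carrier_mat n nc"
    using A B by simp
  have subA: "set (cols A) \<subseteq> carrier_vec n" and subAB: "set (cols (A * B)) \<subseteq> carrier_vec n"
    using A AB cols_dim by blast+
  have vsW: "vectorspace class_ring (vs ?W)" and vsX: "vectorspace class_ring (vs ?X)"
    by (rule subspace_is_vs, rule span_is_subspace, use subA subAB in auto)+
  have smW: "submodule class_ring ?W V" and smX: "submodule class_ring ?X V"
    by (rule span_is_submodule, use subA subAB in auto)+
  \<comment> \<open>A basis of the smaller space stays independent in the larger one, where its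
    cardinality is the full dimension; so it is a basis of both. Independence passes from one space
    to the other through the ambient space.\<close>
  obtain b where fb: "finite b" and b: "vectorspace.basis class_ring (vs ?X) b"
    using vectorspace.finite_basis_exists[OF vsX fin_dim_span_cols[OF AB]] by blast
  have bX: "b \<subseteq> ?X" and indX: "LinearCombinations.module.lin_indpt class_ring (vs ?X) b"
    and genX: "LinearCombinations.module.span class_ring (vs ?X) b = ?X"
    using b unfolding vectorspace.basis_def[OF vsX] by auto
  have bW: "b \<subseteq> ?W"
    using bX span_cols_mult_subset[OF A B] by blast
  have "lin_indpt b"
    using indX span_li_not_depend(2)[OF bX smX] by simp
  then have indW: "LinearCombinations.module.lin_indpt class_ring (vs ?W) b"
    using span_li_not_depend(2)[OF bW smW] by simp
  have "card b = vectorspace.dim class_ring (vs ?W)"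
    using vectorspace.dim_basis[OF vsX fb b] rank unfolding rank_def by simp
  then have "vectorspace.basis class_ring (vs ?W) b"
    by (intro vectorspace.dim_li_is_basis[OF vsW fin_dim_span_cols[OF A] fb _ indW]) (use bW in auto)
  then have "span b = ?W"
    using span_li_not_depend(1)[OF bW smW] unfolding vectorspace.basis_def[OF vsW] by auto
  moreover have "span b = ?X"
    using genX span_li_not_depend(1)[OF bX smX] by simp
  ultimately have WX: "?W = ?X" by simp
  have "\<exists>z \<in> carrier_vec nc. col A j = (A * B) *\<^sub>v z" if "j < m" for j
  proof -
    have "col A j \<in> set (cols A)"
      using that A by (auto simp: cols_def)
    then have "col A j \<in> ?X"
      using span_mem[OF subA] WX by auto
    then show ?thesis
      using span_cols_iff[OF AB] by simp
  qed
  then obtain z where z: "\<And>j. j < m \<Longrightarrow> z j \<in> carrier_vec nc \<and> col A j = (A * B) *\<^sub>v z j"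
    by metis
  define Z where "Z = mat nc m (\<lambda>(i, j). z j $ i)"
  have Z: "Z \<in> carrier_mat nc m"
    unfolding Z_def by simp
  have "A = A * B * Z"
  proof (rule mat_col_eqI)
    fix j assume "j < dim_col (A * B * Z)"
    then have j: "j < m" using Z by simp
    have "col Z j = z j"
      unfolding Z_def using z[OF j] j by (intro eq_vecI) auto
    then show "col A j = col (A * B * Z) j"
      using z[OF j] col_mult2[OF AB Z j] by simp
  qed (use A Z in auto)
  then show ?thesis using Z by blast
qed

end

section \<open>Existence and uniqueness of the Drazin inverse\<close>

lemmas square_assoc = assoc_mult_mat[of _ n n _ n _ n] mult_carrier_mat[of _ n n _ n] for n

section \<open>Powers of square matrices\<close>

lemma pow_mat_add:
  assumes "A \<in> carrier_mat n n"
  shows "A ^\<^sub>m (a + b) = A ^\<^sub>m a * A ^\<^sub>m b"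
proof (induction b)
  case 0
  then show ?case using assms by simp
next
  case (Suc b)
  then show ?case
    using assms assoc_mult_mat[of "A ^\<^sub>m a" n n "A ^\<^sub>m b" n A n] by simp
qed

lemma pow_mat_Suc_left:
  assumes "A \<in> carrier_mat n n"
  shows "A ^\<^sub>m Suc a = A * A ^\<^sub>m a"
  using pow_mat_add[OF assms, of 1 a] assms by simp

lemma pow_mat_transpose:
  fixes A :: "'a :: comm_semiring_1 mat"
  assumes A: "A \<in> carrier_mat n n"
  shows "transpose_mat (A ^\<^sub>m k) = transpose_mat A ^\<^sub>m k"
proof (induction k)
  case (Suc k)
  then show ?case
    using pow_mat_Suc_left[of "transpose_mat A" n k] transpose_mult[of "A ^\<^sub>m k" n n A n] A by simp
qed (use A in simp)

lemma pow_mat_commute: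
  assumes A: "A \<in> carrier_mat n n" and X: "X \<in> carrier_mat n n" and comm: "A * X = X * A"
  shows "A ^\<^sub>m k * X = X * A ^\<^sub>m k"
proof (induction k)
  case (Suc k)
  have "A ^\<^sub>m Suc k * X = A ^\<^sub>m k * (X * A)"
    using A X comm by (simp add: square_assoc[where n = n])
  also have "\<dots> = (A ^\<^sub>m k * X) * A"
    using A X by (simp add: square_assoc[where n = n])
  also have "\<dots> = X * A ^\<^sub>m Suc k"
    unfolding Suc using A X by (simp add: square_assoc[where n = n])
  finally show ?case .
qed (use A X in simp)

section \<open>Uniqueness of the Drazin inverse across exponents\<close>

lemma is_drazin_mono:
  assumes A: "A \<in> carrier_mat n n" and X: "is_drazin j A X" and le: "j \<le> l"
  shows "is_drazin l A X"
proof -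
  have Xc: "X \<in> carrier_mat n n" and eq: "A ^\<^sub>m j * X * A = A ^\<^sub>m j"
    using A X unfolding is_drazin_def by auto
  have "A ^\<^sub>m l = A ^\<^sub>m (l - j) * A ^\<^sub>m j"
    using pow_mat_add[OF A, of "l - j" j] le by simp
  then have "A ^\<^sub>m l * X * A = A ^\<^sub>m (l - j) * (A ^\<^sub>m j * X * A)"
    using A Xc by (simp add: square_assoc[where n = n])
  also have "\<dots> = A ^\<^sub>m l"
    unfolding eq using pow_mat_add[OF A, of "l - j" j] le by simp
  finally show ?thesis
    using X unfolding is_drazin_def by simp
qed

text \<open>Iterates \<open>X = A * X * X\<close>, which combines \<open>X * A * X = X\<close> with
  commutation. It supplies as many factors \<open>A\<close> as the exponent equation needs.\<close>

lemma drazin_eq_pow: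
  assumes A: "A \<in> carrier_mat n n" and X: "is_drazin j A X"
  shows "X = A ^\<^sub>m i * X ^\<^sub>m Suc i"
proof (induction i)
  case 0
  then show ?case using A X unfolding is_drazin_def by auto
next
  case (Suc i)
  have Xc: "X \<in> carrier_mat n n" and XAX: "X * A * X = X" and comm: "A * X = X * A"
    using A X unfolding is_drazin_def by auto
  have "X = A ^\<^sub>m i * (A * X * X * X ^\<^sub>m i)"
    unfolding comm XAX pow_mat_Suc_left[OF Xc, symmetric] by (rule Suc)
  also have "\<dots> = A ^\<^sub>m Suc i * (X * (X * X ^\<^sub>m i))"
    using A Xc by (simp add: square_assoc[where n = n])
  also have "\<dots> = A ^\<^sub>m Suc i * X ^\<^sub>m Suc (Suc i)"
    unfolding pow_mat_Suc_left[OF Xc] ..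
  finally show ?case .
qed

text \<open>Both solutions are first brought to the common exponent \<open>l = max i j\<close>. The
  trailing \<open>A ^\<^sub>m l\<close> in \<open>X\<close> absorbs \<open>Y * A\<close>, and the
  leading \<open>A ^\<^sub>m l\<close> in \<open>Y\<close> absorbs \<open>X * A\<close>; hence both
  equal \<open>X * A * Y\<close>.\<close>

lemma drazin_unique:
  assumes A: "A \<in> carrier_mat n n" and X: "is_drazin i A X" and Y: "is_drazin j A Y"
  shows "X = Y"
proof -
  define l where "l = max i j"
  have X': "is_drazin l A X" and Y': "is_drazin l A Y"
    using is_drazin_mono[OF A X] is_drazin_mono[OF A Y] unfolding l_def by auto
  have Xc: "X \<in> carrier_mat n n" and Xl: "A ^\<^sub>m l * X * A = A ^\<^sub>m l" and Xcomm: "A * X = X * A"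
    and Yc: "Y \<in> carrier_mat n n" and Yl: "A ^\<^sub>m l * Y * A = A ^\<^sub>m l" and Ycomm: "A * Y = Y * A"
    using A X' Y' unfolding is_drazin_def by auto
  note assoc = square_assoc[where n = n]
  have "X * (A * A ^\<^sub>m l) = X * A ^\<^sub>m l * A"
    unfolding pow_mat_Suc_left[OF A, symmetric] using A Xc by (simp add: assoc)
  then have XAl: "X * (A * A ^\<^sub>m l) = A ^\<^sub>m l"
    using Xl pow_mat_commute[OF A Xc Xcomm, of l] by simp
  have "A * X ^\<^sub>m Suc l = X ^\<^sub>m Suc l * A"
    using pow_mat_commute[OF Xc A Xcomm[symmetric], of "Suc l"] by simp
  then have "A ^\<^sub>m l * X ^\<^sub>m Suc l = X ^\<^sub>m Suc l * A ^\<^sub>m l"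
    by (rule pow_mat_commute[OF A pow_carrier_mat[OF Xc]])
  then have X_eq: "X = X ^\<^sub>m Suc l * A ^\<^sub>m l"
    using drazin_eq_pow[OF A X', of l] by simp
  have "X = X ^\<^sub>m Suc l * (A ^\<^sub>m l * Y * A)"
    unfolding Yl by (rule X_eq)
  also have "\<dots> = (X ^\<^sub>m Suc l * A ^\<^sub>m l) * (Y * A)"
    using A Xc Yc by (simp add: assoc)
  also have "\<dots> = X * (A * Y)"
    unfolding X_eq[symmetric] Ycomm ..
  also have "\<dots> = X * (A * (A ^\<^sub>m l * Y ^\<^sub>m Suc l))"
    unfolding drazin_eq_pow[OF A Y', of l, symmetric] ..
  also have "\<dots> = X * (A * A ^\<^sub>m l) * Y ^\<^sub>m Suc l"
    using A Xc Yc by (simp add: assoc)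
  also have "\<dots> = Y"
    unfolding XAl drazin_eq_pow[OF A Y', of l, symmetric] ..
  finally show ?thesis .
qed

section \<open>Existence of the Drazin inverse\<close>

lemma pow_mat_absorb_right:
  assumes A: "A \<in> carrier_mat n n" and Z: "Z \<in> carrier_mat n n"
    and eq: "A ^\<^sub>m m = A ^\<^sub>m Suc m * Z"
  shows "A ^\<^sub>m (i + m) * Z ^\<^sub>m i = A ^\<^sub>m m"
proof (induction i)
  case (Suc i)
  note assoc = square_assoc[where n = n]
  have "A ^\<^sub>m (Suc i + m) * Z ^\<^sub>m Suc i = A * (A ^\<^sub>m (i + m) * Z ^\<^sub>m i) * Z"
    using pow_mat_Suc_left[OF A, of "i + m"] A Z by (simp add: assoc)
  also have "\<dots> = A ^\<^sub>m Suc m * Z"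
    unfolding Suc pow_mat_Suc_left[OF A] ..
  finally show ?case unfolding eq[symmetric] .
qed (use A Z in simp)

text \<open>The classical construction for strongly pi-regular elements. The candidate has the two
  forms \<open>A ^\<^sub>m m * Z ^\<^sub>m Suc m\<close> and
  \<open>W ^\<^sub>m Suc m * A ^\<^sub>m m\<close>; the first evaluates \<open>A * X\<close>, the
  second \<open>X * A\<close>, and both give \<open>A ^\<^sub>m m * Z ^\<^sub>m m\<close>.\<close>

lemma drazin_exists_of_factors:
  assumes A: "A \<in> carrier_mat n n" and Z: "Z \<in> carrier_mat n n" and W: "W \<in> carrier_mat n n"
    and AZ: "A ^\<^sub>m m = A ^\<^sub>m Suc m * Z" and WA: "A ^\<^sub>m m = W * A ^\<^sub>m Suc m"
  shows "is_drazin m A (A ^\<^sub>m m * Z ^\<^sub>m Suc m)"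
proof -
  note assoc = square_assoc[where n = n]
  \<comment> \<open>Both sides equal \<open>W * A ^\<^sub>m Suc m * Z\<close>.\<close>
  have step: "A ^\<^sub>m m * Z = W * A ^\<^sub>m m"
  proof -
    have "A ^\<^sub>m m * Z = W * A ^\<^sub>m Suc m * Z" unfolding WA[symmetric] ..
    also have "\<dots> = W * (A ^\<^sub>m Suc m * Z)" using A W Z by (simp add: assoc)
    finally show ?thesis unfolding AZ[symmetric] .
  qed
  have swap: "A ^\<^sub>m m * Z ^\<^sub>m i = W ^\<^sub>m i * A ^\<^sub>m m" for i
  proof (induction i)
    case (Suc i)
    have "A ^\<^sub>m m * Z ^\<^sub>m Suc i = (A ^\<^sub>m m * Z ^\<^sub>m i) * Z"
      using A Z by (simp add: assoc)
    also have "\<dots> = W ^\<^sub>m i * (A ^\<^sub>m m * Z)"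
      unfolding Suc using A W Z by (simp add: assoc)
    also have "\<dots> = W ^\<^sub>m Suc i * A ^\<^sub>m m"
      unfolding step using A W by (simp add: assoc)
    finally show ?case .
  qed (use A Z W in simp)
  define X where "X = A ^\<^sub>m m * Z ^\<^sub>m Suc m"
  have X: "X \<in> carrier_mat n n"
    unfolding X_def using A Z by (simp add: assoc)
  have XW: "X = W ^\<^sub>m Suc m * A ^\<^sub>m m"
    unfolding X_def by (rule swap)
  have AX: "A * X = A ^\<^sub>m m * Z ^\<^sub>m m"
  proof -
    have "A * X = (A * A ^\<^sub>m m * Z) * Z ^\<^sub>m m"
      unfolding X_def pow_mat_Suc_left[OF Z] using A Z by (simp add: assoc)
    also have "\<dots> = A ^\<^sub>m m * Z ^\<^sub>m m"
      unfolding pow_mat_Suc_left[OF A, symmetric] AZ[symmetric] ..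
    finally show ?thesis .
  qed
  have XA: "X * A = A ^\<^sub>m m * Z ^\<^sub>m m"
  proof -
    have "X * A = W ^\<^sub>m m * (W * A ^\<^sub>m Suc m)"
      unfolding XW using A W by (simp add: assoc)
    then show ?thesis
      unfolding WA[symmetric] swap[symmetric] .
  qed
  have "A ^\<^sub>m m * X * A = A ^\<^sub>m m * (A ^\<^sub>m m * Z ^\<^sub>m m)"
    using XA A X by (simp add: assoc)
  also have "\<dots> = A ^\<^sub>m (m + m) * Z ^\<^sub>m m"
    unfolding pow_mat_add[OF A] using A Z by (simp add: assoc)
  also have "\<dots> = A ^\<^sub>m m"
    by (rule pow_mat_absorb_right[OF A Z AZ])
  finally have 1: "A ^\<^sub>m m * X * A = A ^\<^sub>m m" .
  have "X * A * X = X * (A ^\<^sub>m m * Z ^\<^sub>m m)"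
    using AX A X by (simp add: assoc)
  also have "\<dots> = W ^\<^sub>m Suc m * (A ^\<^sub>m (m + m) * Z ^\<^sub>m m)"
    unfolding XW pow_mat_add[OF A] using A W Z by (simp add: assoc del: pow_mat.simps)
  also have "\<dots> = X"
    unfolding pow_mat_absorb_right[OF A Z AZ] XW ..
  finally have 2: "X * A * X = X" .
  show ?thesis
    unfolding X_def[symmetric] is_drazin_def using 1 2 X A AX XA by simp
qed

text \<open>Otherwise the ranks would be a strictly decreasing sequence of natural numbers. This
  makes the \<open>LEAST\<close> in \<open>mat_Ind\<close> meaningful.\<close>

lemma rank_pow_stabilizes:
  fixes A :: "'a :: field mat"
  assumes A: "A \<in> carrier_mat n n"
  shows "\<exists>k. vec_space.rank n (A ^\<^sub>m k) = vec_space.rank n (A ^\<^sub>m (k + 1))"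
proof (rule ccontr)
  assume neg: "\<not> ?thesis"
  have "vec_space.rank n (A ^\<^sub>m Suc k) \<le> vec_space.rank n (A ^\<^sub>m k)" for k
    using vec_space.rank_mult_le[of "A ^\<^sub>m k" n n A n] A by simp
  then have less: "vec_space.rank n (A ^\<^sub>m Suc k) < vec_space.rank n (A ^\<^sub>m k)" for k
    using neg by (metis Suc_eq_plus1 le_neq_implies_less)
  have "vec_space.rank n (A ^\<^sub>m k) + k \<le> vec_space.rank n (A ^\<^sub>m 0)" for k
  proof (induction k)
    case (Suc k)
    then show ?case using less[of k] by linarith
  qed simp
  from this[of "Suc (vec_space.rank n (A ^\<^sub>m 0))"] show False by simp
qed

lemma rank_pow_eq_imp_factor:
  fixes A :: "'a :: field mat"
  assumes A: "A \<in> carrier_mat n n"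
    and rank: "vec_space.rank n (A ^\<^sub>m k) = vec_space.rank n (A ^\<^sub>m (k + 1))"
  shows "\<exists>Z \<in> carrier_mat n n. A ^\<^sub>m k = A ^\<^sub>m Suc k * Z"
  using vec_space.rank_mult_eq_imp_factor[of "A ^\<^sub>m k" n n A n] A rank by simp

text \<open>The right factor comes from the index of \<open>A\<close>, the left one from a stable
  exponent \<open>l\<close> of the transpose. The exponents \<open>k\<close> and \<open>l\<close>
  are not compared: at \<open>k + l\<close> both factorisations hold, and the exponent is lowered to
  \<open>k\<close> afterwards.\<close>

lemma drazin_exists:
  assumes A: "A \<in> carrier_mat n n"
  shows "\<exists>X. is_drazin (mat_Ind A) A X"
proof -
  note assoc = square_assoc[where n = n]
  define k where "k = mat_Ind A"
  have "vec_space.rank n (A ^\<^sub>m k) = vec_space.rank n (A ^\<^sub>m (k + 1))"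
    using LeastI_ex[OF rank_pow_stabilizes[OF A]] A unfolding k_def mat_Ind_def by auto
  then obtain Z where Z: "Z \<in> carrier_mat n n" and AZ: "A ^\<^sub>m k = A ^\<^sub>m Suc k * Z"
    using rank_pow_eq_imp_factor[OF A] by blast
  have At: "transpose_mat A \<in> carrier_mat n n"
    using A by simp
  obtain l V where V: "V \<in> carrier_mat n n"
    and AV: "transpose_mat A ^\<^sub>m l = transpose_mat A ^\<^sub>m Suc l * V"
    using rank_pow_stabilizes[OF At] rank_pow_eq_imp_factor[OF At] by blast
  define W where "W = transpose_mat V"
  have W: "W \<in> carrier_mat n n"
    unfolding W_def using V by simp
  have "transpose_mat (A ^\<^sub>m l) = transpose_mat (A ^\<^sub>m Suc l) * V"
    using AV unfolding pow_mat_transpose[OF A] .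
  from arg_cong[OF this, of transpose_mat] have WA: "A ^\<^sub>m l = W * A ^\<^sub>m Suc l"
    using transpose_mult[of "transpose_mat (A ^\<^sub>m Suc l)" n n V n] A V unfolding W_def
    by (simp del: pow_mat.simps)
  define m where "m = k + l"
  have AZm: "A ^\<^sub>m m = A ^\<^sub>m Suc m * Z"
  proof -
    have "A ^\<^sub>m m = A ^\<^sub>m (l + k)"
      unfolding m_def by (simp add: add.commute)
    also have "\<dots> = A ^\<^sub>m l * (A ^\<^sub>m Suc k * Z)"
      unfolding AZ[symmetric] by (rule pow_mat_add[OF A])
    also have "\<dots> = A ^\<^sub>m (l + Suc k) * Z"
      unfolding pow_mat_add[OF A] using A Z by (simp add: assoc)
    also have "l + Suc k = Suc m"
      unfolding m_def by simp
    finally show ?thesis .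
  qed
  have WAm: "A ^\<^sub>m m = W * A ^\<^sub>m Suc m"
  proof -
    have "A ^\<^sub>m m = A ^\<^sub>m (l + k)"
      unfolding m_def by (simp add: add.commute)
    also have "\<dots> = W * A ^\<^sub>m Suc l * A ^\<^sub>m k"
      unfolding WA[symmetric] by (rule pow_mat_add[OF A])
    also have "\<dots> = W * A ^\<^sub>m (Suc l + k)"
      unfolding pow_mat_add[OF A] using A W by (simp add: assoc)
    also have "Suc l + k = Suc m"
      unfolding m_def by simp
    finally show ?thesis .
  qed
  define X where "X = A ^\<^sub>m m * Z ^\<^sub>m Suc m"
  have dr: "is_drazin m A X"
    unfolding X_def by (rule drazin_exists_of_factors[OF A Z W AZm WAm])
  then have X: "X \<in> carrier_mat n n" and eq: "A ^\<^sub>m m * X * A = A ^\<^sub>m m" and comm: "A * X = X * A"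
    using A unfolding is_drazin_def by auto
  have "A * (X * A) = X * A * A"
    using assoc_mult_mat[OF A X A] comm by simp
  then have commk: "A ^\<^sub>m i * (X * A) = X * A * A ^\<^sub>m i" for i
    by (intro pow_mat_commute[OF A mult_carrier_mat[OF X A]])
  \<comment> \<open>Lowering the exponent from \<open>m\<close> to \<open>k\<close>:
    \<open>X * A\<close> fixes \<open>A ^\<^sub>m m\<close> and commutes with the powers of
    \<open>A\<close>. Since \<open>A ^\<^sub>m k\<close> has \<open>A ^\<^sub>m m\<close> as a left
    factor, \<open>X * A\<close> fixes it too.\<close>
  have "A ^\<^sub>m m * (A ^\<^sub>m k * Z ^\<^sub>m m) = A ^\<^sub>m (m + k) * Z ^\<^sub>m m"
    unfolding pow_mat_add[OF A] using A Z by (simp add: assoc)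
  then have Ak: "A ^\<^sub>m m * (A ^\<^sub>m k * Z ^\<^sub>m m) = A ^\<^sub>m k"
    unfolding pow_mat_absorb_right[OF A Z AZ] .
  have "A ^\<^sub>m k * X * A = X * A * A ^\<^sub>m k"
    unfolding commk[symmetric] using A X by (simp add: assoc)
  also have "\<dots> = X * A * (A ^\<^sub>m m * (A ^\<^sub>m k * Z ^\<^sub>m m))"
    unfolding Ak ..
  also have "\<dots> = X * A * A ^\<^sub>m m * (A ^\<^sub>m k * Z ^\<^sub>m m)"
    using A X Z by (simp add: assoc)
  also have "X * A * A ^\<^sub>m m = A ^\<^sub>m m"
    unfolding commk[symmetric] using eq A X by (simp add: assoc)
  also note Ak
  finally show ?thesis
    using dr unfolding is_drazin_def k_def by blast
qed

lemma is_drazin_drazin_inv: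
  assumes A: "A \<in> carrier_mat n n"
  shows "is_drazin (mat_Ind A) A (drazin_inv A)"
  unfolding drazin_inv_def
  using drazin_exists[OF A] drazin_unique[OF A] by (metis theI)

lemma drazin_inv_eqI:
  assumes A: "A \<in> carrier_mat n n" and X: "is_drazin j A X"
  shows "drazin_inv A = X"
  using drazin_unique[OF A is_drazin_drazin_inv[OF A] X] .

section \<open>Dual matrices\<close>

lemma dual_mat_carrier [simp]:
  "A \<in> carrier_mat nr nc \<Longrightarrow> A\<^sub>0 \<in> carrier_mat nr nc \<Longrightarrow> dual_mat A A\<^sub>0 \<in> carrier_mat nr nc"
  unfolding dual_mat_def by auto

text \<open>Addition of matrices takes its dimensions from the second summand, here the
  infinitesimal part.\<close>

lemma dual_mat_dim [simp]:
  "dim_row (dual_mat A A\<^sub>0) = dim_row A\<^sub>0" "dim_col (dual_mat A A\<^sub>0) = dim_col A\<^sub>0"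
  unfolding dual_mat_def by auto

lemma std_inf_carrier [simp]:
  "std_mat X \<in> carrier_mat nr nc \<longleftrightarrow> X \<in> carrier_mat nr nc"
  "inf_mat X \<in> carrier_mat nr nc \<longleftrightarrow> X \<in> carrier_mat nr nc"
  unfolding std_mat_def inf_mat_def by auto

lemma dual_mat_index:
  assumes "A \<in> carrier_mat nr nc" "A\<^sub>0 \<in> carrier_mat nr nc" "i < nr" "j < nc"
  shows "dual_mat A A\<^sub>0 $$ (i, j) = Dual (A $$ (i, j)) (A\<^sub>0 $$ (i, j))"
  using assms by (simp add: dual_mat_def Dual_eq)

lemma std_inf_dual_mat:
  assumes "A \<in> carrier_mat nr nc" "A\<^sub>0 \<in> carrier_mat nr nc"
  shows "std_mat (dual_mat A A\<^sub>0) = A" "inf_mat (dual_mat A A\<^sub>0) = A\<^sub>0"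
  using assms dual_mat_index[OF assms] dual_mat_carrier[OF assms]
  by (auto simp: std_mat_def inf_mat_def intro!: eq_matI)

lemma Dual_sum: "(\<Sum>i\<in>I. Dual (f i) (g i)) = Dual (sum f I) (sum g I)"
  by (induction I rule: infinite_finite_induct)
    (auto simp: zero_dual_complex_def plus_dual_complex_def)

text \<open>The product rule: the term with \<open>A\<^sub>0 * B\<^sub>0\<close> carries the square
  of \<open>eps\<close> and disappears.\<close>

lemma dual_mat_mult:
  assumes A: "A \<in> carrier_mat nr n" and A\<^sub>0: "A\<^sub>0 \<in> carrier_mat nr n"
    and B: "B \<in> carrier_mat n nc" and B\<^sub>0: "B\<^sub>0 \<in> carrier_mat n nc"
  shows "dual_mat A A\<^sub>0 * dual_mat B B\<^sub>0 = dual_mat (A * B) (A * B\<^sub>0 + A\<^sub>0 * B)"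
proof (rule eq_matI)
  fix i j assume "i < dim_row (dual_mat (A * B) (A * B\<^sub>0 + A\<^sub>0 * B))"
    and "j < dim_col (dual_mat (A * B) (A * B\<^sub>0 + A\<^sub>0 * B))"
  then have i: "i < nr" and j: "j < nc"
    using A A\<^sub>0 B B\<^sub>0 by auto
  have "(dual_mat A A\<^sub>0 * dual_mat B B\<^sub>0) $$ (i, j)
      = (\<Sum>l\<in>{0..<n}. dual_mat A A\<^sub>0 $$ (i, l) * dual_mat B B\<^sub>0 $$ (l, j))"
    using i j A A\<^sub>0 B B\<^sub>0 by (simp add: scalar_prod_def)
  also have "\<dots> = (\<Sum>l\<in>{0..<n}. Dual (A $$ (i, l) * B $$ (l, j))
      (A $$ (i, l) * B\<^sub>0 $$ (l, j) + A\<^sub>0 $$ (i, l) * B $$ (l, j)))"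
    using i j by (intro sum.cong)
      (simp_all add: dual_mat_index[OF A A\<^sub>0] dual_mat_index[OF B B\<^sub>0] times_dual_complex_def)
  also have "\<dots> = Dual ((A * B) $$ (i, j)) ((A * B\<^sub>0 + A\<^sub>0 * B) $$ (i, j))"
    unfolding Dual_sum using A A\<^sub>0 B B\<^sub>0 i j by (simp add: scalar_prod_def sum.distrib)
  also have "\<dots> = dual_mat (A * B) (A * B\<^sub>0 + A\<^sub>0 * B) $$ (i, j)"
    using A A\<^sub>0 B B\<^sub>0 i j by (intro dual_mat_index[symmetric]) auto
  finally show "(dual_mat A A\<^sub>0 * dual_mat B B\<^sub>0) $$ (i, j)
      = dual_mat (A * B) (A * B\<^sub>0 + A\<^sub>0 * B) $$ (i, j)" .
qed (use A A\<^sub>0 B B\<^sub>0 in auto)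

lemma std_mat_mult:
  assumes "X \<in> carrier_mat nr n" "Y \<in> carrier_mat n nc"
  shows "std_mat (X * Y) = std_mat X * std_mat Y"
  using dual_mat_mult[of "std_mat X" nr n "inf_mat X" "std_mat Y" nc "inf_mat Y"] assms
    std_inf_dual_mat(1)[of "std_mat X * std_mat Y" nr nc "std_mat X * inf_mat Y + inf_mat X * std_mat Y"]
  by (simp add: dual_mat_std_inf)

lemma four_block_dual_mat:
  assumes "A \<in> carrier_mat nr1 nc1" "A\<^sub>0 \<in> carrier_mat nr1 nc1"
    and "B \<in> carrier_mat nr1 nc2" "B\<^sub>0 \<in> carrier_mat nr1 nc2"
    and "C \<in> carrier_mat nr2 nc1" "C\<^sub>0 \<in> carrier_mat nr2 nc1"
    and "D \<in> carrier_mat nr2 nc2" "D\<^sub>0 \<in> carrier_mat nr2 nc2"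
  shows "four_block_mat (dual_mat A A\<^sub>0) (dual_mat B B\<^sub>0) (dual_mat C C\<^sub>0) (dual_mat D D\<^sub>0)
    = dual_mat (four_block_mat A B C D) (four_block_mat A\<^sub>0 B\<^sub>0 C\<^sub>0 D\<^sub>0)"
  using assms by (intro eq_matI) (auto simp: dual_mat_def)

section \<open>The infinitesimal part of the dual Drazin inverse\<close>

lemma msum_empty: "msum n f {} = 0\<^sub>m n n"
proof -
  interpret abelian_group "module_mat TYPE(complex) n n"
    by (rule abelian_group_mat)
  show ?thesis by (simp add: module_mat_simps)
qed

lemma msum_insert:
  assumes "finite I" "i \<notin> I" "\<And>j. f j \<in> carrier_mat n n"
  shows "msum n f (insert i I) = f i + msum n f I"
proof -
  interpret abelian_group "module_mat TYPE(complex) n n"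
    by (rule abelian_group_mat)
  show ?thesis
    using finsum_insert[of I i f] assms by (simp add: module_mat_simps Pi_def)
qed

lemma msum_carrier:
  assumes "\<And>j. f j \<in> carrier_mat n n"
  shows "msum n f I \<in> carrier_mat n n"
proof -
  interpret abelian_group "module_mat TYPE(complex) n n"
    by (rule abelian_group_mat)
  show ?thesis
    using finsum_closed[of f I] assms by (simp add: module_mat_simps Pi_def)
qed

lemma msum_atLeast0LessThan_Suc:
  assumes "\<And>j. f j \<in> carrier_mat n n"
  shows "msum n f {0..<Suc m} = f m + msum n f {0..<m}"
  using msum_insert[of "{0..<m}" m f n] assms by (simp add: atLeast0_lessThan_Suc)

lemma mult_msum_left:
  assumes B: "B \<in> carrier_mat n n" and f: "\<And>j. f j \<in> carrier_mat n n" and I: "finite I"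
  shows "B * msum n f I = msum n (\<lambda>i. B * f i) I"
  using I
proof (induction I)
  case empty
  then show ?case using B by (simp add: msum_empty)
next
  case (insert i I)
  have "B * msum n f (insert i I) = B * f i + B * msum n f I"
    unfolding msum_insert[of I i f n, OF insert.hyps f]
    by (rule mult_add_distrib_mat[OF B f msum_carrier[of f, OF f]])
  also have "\<dots> = msum n (\<lambda>i. B * f i) (insert i I)"
    unfolding insert.IH using B f
    by (intro msum_insert[symmetric, OF insert.hyps]) auto
  finally show ?case .
qed

text \<open>The directional derivative of the \<open>k\<close>-th power at \<open>A\<close> along
  \<open>A\<^sub>0\<close>, written as the sum that occurs in \<open>DC_z\<close>. By
  \<open>dual_mat_pow\<close> it is the infinitesimal part of the \<open>k\<close>-th power of the
  dual matrix.\<close>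

definition pow_deriv :: "nat \<Rightarrow> complex mat \<Rightarrow> complex mat \<Rightarrow> nat \<Rightarrow> complex mat" where
  "pow_deriv n A A\<^sub>0 k = msum n (\<lambda>i. A ^\<^sub>m (k - i) * A\<^sub>0 * A ^\<^sub>m (i - 1)) {1..k}"

lemma pow_deriv_carrier [simp]:
  assumes A: "A \<in> carrier_mat n n" and A\<^sub>0: "A\<^sub>0 \<in> carrier_mat n n"
  shows "pow_deriv n A A\<^sub>0 k \<in> carrier_mat n n"
  unfolding pow_deriv_def using A A\<^sub>0 by (intro msum_carrier mult_carrier_mat[of _ n n]) auto

text \<open>The Leibniz rule with one factor \<open>A\<close> split off on the left: the top summand
  becomes \<open>A\<^sub>0 * A ^\<^sub>m k\<close>, the others gain a factor
  \<open>A\<close>.\<close>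

lemma pow_deriv_Suc:
  assumes A: "A \<in> carrier_mat n n" and A\<^sub>0: "A\<^sub>0 \<in> carrier_mat n n"
  shows "pow_deriv n A A\<^sub>0 (Suc k) = A * pow_deriv n A A\<^sub>0 k + A\<^sub>0 * A ^\<^sub>m k"
proof -
  note assoc = square_assoc[where n = n]
  interpret abelian_group "module_mat TYPE(complex) n n"
    by (rule abelian_group_mat)
  let ?f = "\<lambda>k i. A ^\<^sub>m (k - i) * A\<^sub>0 * A ^\<^sub>m (i - 1)"
  have f: "?f k i \<in> carrier_mat n n" for k i
    using A A\<^sub>0 by (simp add: assoc)
  have "msum n (?f (Suc k)) {1..k} = msum n (\<lambda>i. A * ?f k i) {1..k}"
  proof (rule finsum_cong')
    fix i assume "i \<in> {1..k}"
    \<comment> \<open>Subtraction is truncated, so this needs \<open>i\<close> to be at most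
      \<open>k\<close>.\<close>
    then have "Suc k - i = Suc (k - i)" by auto
    then show "?f (Suc k) i = A * ?f k i"
      using A A\<^sub>0 by (simp add: pow_mat_Suc_left[OF A] assoc del: pow_mat.simps)
  qed (use A f in \<open>auto simp: module_mat_simps simp del: pow_mat.simps\<close>)
  also have "\<dots> = A * pow_deriv n A A\<^sub>0 k"
    unfolding pow_deriv_def using mult_msum_left[OF A f] by simp
  finally have "msum n (?f (Suc k)) {1..k} = A * pow_deriv n A A\<^sub>0 k" .
  moreover have "pow_deriv n A A\<^sub>0 (Suc k) = ?f (Suc k) (Suc k) + msum n (?f (Suc k)) {1..k}"
    unfolding pow_deriv_def
    using msum_insert[of "{1..k}" "Suc k" "?f (Suc k)" n, OF _ _ f]
    by (simp add: atLeastAtMostSuc_conv)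
  moreover have "?f (Suc k) (Suc k) = A\<^sub>0 * A ^\<^sub>m k"
    using A A\<^sub>0 by simp
  ultimately show ?thesis
    using comm_add_mat[of "A\<^sub>0 * A ^\<^sub>m k" n n "A * pow_deriv n A A\<^sub>0 k"] A A\<^sub>0 by simp
qed

lemma dual_mat_pow:
  assumes A: "A \<in> carrier_mat n n" and A\<^sub>0: "A\<^sub>0 \<in> carrier_mat n n"
  shows "dual_mat A A\<^sub>0 ^\<^sub>m k = dual_mat (A ^\<^sub>m k) (pow_deriv n A A\<^sub>0 k)"
proof (induction k)
  case 0
  have "1\<^sub>m n = dual_mat (1\<^sub>m n) (0\<^sub>m n n)"
    by (intro eq_matI)
      (auto simp: dual_mat_index[of _ n n] one_dual_complex_def zero_dual_complex_def dual_mat_def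
        simp flip: Dual_eq)
  then show ?case
    using A A\<^sub>0 dual_mat_carrier[OF A A\<^sub>0] by (simp add: pow_deriv_def msum_empty)
next
  case (Suc k)
  have "dual_mat A A\<^sub>0 ^\<^sub>m Suc k = dual_mat A A\<^sub>0 * dual_mat (A ^\<^sub>m k) (pow_deriv n A A\<^sub>0 k)"
    unfolding pow_mat_Suc_left[OF dual_mat_carrier[OF A A\<^sub>0]] Suc ..
  also have "\<dots> = dual_mat (A * A ^\<^sub>m k) (A * pow_deriv n A A\<^sub>0 k + A\<^sub>0 * A ^\<^sub>m k)"
    using A A\<^sub>0 by (intro dual_mat_mult) auto
  finally show ?case
    unfolding pow_mat_Suc_left[OF A] pow_deriv_Suc[OF A A\<^sub>0] .
qed

text \<open>The general rules leave the inner dimensions schematic, which makes the simplifier backtrack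
  exponentially; instances with fixed dimensions replace them.\<close>

bundle square_mat_simps =
  mult_carrier_mat[simp del] assoc_mult_mat[simp del] assoc_add_mat[simp del]

section \<open>Spectral projections, telescoping sums and the dual Drazin equations\<close>

context
  includes square_mat_simps
  fixes n k :: nat and A A\<^sub>0 D P :: "complex mat"
  assumes A: "A \<in> carrier_mat n n" and A\<^sub>0: "A\<^sub>0 \<in> carrier_mat n n"
    and drazin: "is_drazin k A D"
    and P_def: "P = 1\<^sub>m n - A * D"
begin

private lemmas assoc = square_assoc[where n = n]
private lemmas dist = mult_add_distrib_mat[of _ n n _ n] add_mult_distrib_mat[of _ n n _ _ n]
  minus_mult_distrib_mat[of _ n n _ _ n] mult_minus_distrib_mat[of _ n n _ n]
  assoc_add_mat[of _ n n] add_carrier_mat[of _ n n] uminus_carrier_mat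

private lemma D: "D \<in> carrier_mat n n" and eqk: "A ^\<^sub>m k * D * A = A ^\<^sub>m k"
  and DAD: "D * A * D = D" and comm: "A * D = D * A" and P: "P \<in> carrier_mat n n"
  using A drazin unfolding is_drazin_def P_def by auto

private lemmas dims [simp] = A[THEN carrier_matD(1)] A[THEN carrier_matD(2)]
  A\<^sub>0[THEN carrier_matD(1)] A\<^sub>0[THEN carrier_matD(2)]
  D[THEN carrier_matD(1)] D[THEN carrier_matD(2)] P[THEN carrier_matD(1)] P[THEN carrier_matD(2)]

private lemma AD: "A * D \<in> carrier_mat n n"
  using A D by (simp add: assoc)

text \<open>\<open>A * D\<close> and \<open>P\<close> are the complementary spectral idempotents of
  \<open>A\<close>; on the range of \<open>P\<close> the matrix \<open>A\<close> is nilpotent, and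
  the exponent equation says that \<open>k\<close> factors suffice.\<close>

private lemma proj: "D * P = 0\<^sub>m n n" "P * D = 0\<^sub>m n n" "A * P = P * A" "A ^\<^sub>m k * P = 0\<^sub>m n n"
  "P * P = P" "A * D + P = 1\<^sub>m n"
proof -
  have 1: "A * D * D = D" "D * (A * D) = D"
    using DAD comm A D by (simp_all add: assoc)
  show "D * P = 0\<^sub>m n n" "P * D = 0\<^sub>m n n"
    unfolding P_def using A D 1 by (simp_all add: dist AD)
  have "A * (A * D) = A * (D * A)"
    unfolding comm ..
  also have "\<dots> = A * D * A"
    using A D by (simp add: assoc)
  finally have "A * (A * D) = A * D * A" .
  then show "A * P = P * A"
    unfolding P_def using A D by (simp add: dist AD)
  have "A ^\<^sub>m k * (A * D) = A ^\<^sub>m k"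
    unfolding comm using eqk A D by (simp add: assoc)
  then show "A ^\<^sub>m k * P = 0\<^sub>m n n"
    unfolding P_def using A D by (simp add: dist AD)
  have ADP: "A * D * P = 0\<^sub>m n n"
    using \<open>D * P = 0\<^sub>m n n\<close> A D P by (simp add: assoc)
  have "(1\<^sub>m n - A * D) * P = P"
    unfolding minus_mult_distrib_mat[OF one_carrier_mat AD P] ADP by (intro eq_matI) simp_all
  then show "P * P = P"
    unfolding P_def .
  show "A * D + P = 1\<^sub>m n"
    unfolding P_def using AD by (intro eq_matI) (simp_all del: index_mult_mat(1))
qed

private lemma powA_P: "A ^\<^sub>m i * P = P * A ^\<^sub>m i"
  by (rule pow_mat_commute[OF A P proj(3)])

text \<open>A factor \<open>A\<close> cancels one \<open>D\<close> only while another
  \<open>D\<close> remains, because \<open>A * D\<close> alone is an idempotent and not the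
  identity; hence the exponents start at 2.\<close>

private lemma A_powD: "A * D ^\<^sub>m Suc (Suc i) = D ^\<^sub>m Suc i" "D ^\<^sub>m Suc (Suc i) * A = D ^\<^sub>m Suc i"
proof -
  have "A * D ^\<^sub>m Suc (Suc i) = (D * A * D) * D ^\<^sub>m i"
    unfolding pow_mat_Suc_left[OF D] comm[symmetric] using A D by (simp add: assoc)
  then show "A * D ^\<^sub>m Suc (Suc i) = D ^\<^sub>m Suc i"
    unfolding DAD pow_mat_Suc_left[OF D] .
  have "D ^\<^sub>m Suc (Suc i) * A = D ^\<^sub>m i * (D * (D * A))"
    using A D by (simp add: assoc)
  also have "\<dots> = D ^\<^sub>m i * (D * A * D)"
    using A D by (simp add: assoc comm)
  finally show "D ^\<^sub>m Suc (Suc i) * A = D ^\<^sub>m Suc i"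
    unfolding DAD by simp
qed

private lemma E_powD: "A * D * D ^\<^sub>m Suc i = D ^\<^sub>m Suc i" "D ^\<^sub>m Suc i * (A * D) = D ^\<^sub>m Suc i"
proof -
  have "A * D * D ^\<^sub>m Suc i = (D * A * D) * D ^\<^sub>m i"
    unfolding pow_mat_Suc_left[OF D] comm using A D by (simp add: assoc)
  then show "A * D * D ^\<^sub>m Suc i = D ^\<^sub>m Suc i"
    unfolding DAD pow_mat_Suc_left[OF D] .
  have "D ^\<^sub>m Suc i * (A * D) = D ^\<^sub>m i * (D * A * D)"
    using A D by (simp add: assoc)
  then show "D ^\<^sub>m Suc i * (A * D) = D ^\<^sub>m Suc i"
    unfolding DAD by simp
qed

text \<open>\<open>U k\<close> and \<open>V k\<close> are the two off-diagonal blocks of the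
  infinitesimal part with respect to the splitting \<open>A * D + P = 1\<^sub>m n\<close>. The
  length \<open>m\<close> is left free so that telescoping can proceed by induction.\<close>

private definition U :: "nat \<Rightarrow> complex mat" where
  "U m = msum n (\<lambda>i. D ^\<^sub>m (i + 2) * A\<^sub>0 * A ^\<^sub>m i * P) {0..<m}"

private definition V :: "nat \<Rightarrow> complex mat" where
  "V m = msum n (\<lambda>i. P * A ^\<^sub>m i * A\<^sub>0 * D ^\<^sub>m (i + 2)) {0..<m}"

private lemma UV_term: "D ^\<^sub>m (i + 2) * A\<^sub>0 * A ^\<^sub>m i * P \<in> carrier_mat n n"
  "P * A ^\<^sub>m i * A\<^sub>0 * D ^\<^sub>m (i + 2) \<in> carrier_mat n n"
  using A A\<^sub>0 D P by (simp_all add: assoc)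

private lemma UV [simp]: "U m \<in> carrier_mat n n" "V m \<in> carrier_mat n n"
  unfolding U_def V_def by (rule msum_carrier, rule UV_term)+

private lemmas UV_dims [simp] = UV(1)[THEN carrier_matD(1)] UV(1)[THEN carrier_matD(2)]
  UV(2)[THEN carrier_matD(1)] UV(2)[THEN carrier_matD(2)]

private lemma UV_0: "U 0 = 0\<^sub>m n n" "V 0 = 0\<^sub>m n n"
  by (simp_all add: U_def V_def msum_empty)

private lemma UV_Suc: "U (Suc m) = D ^\<^sub>m (m + 2) * A\<^sub>0 * A ^\<^sub>m m * P + U m"
  "V (Suc m) = P * A ^\<^sub>m m * A\<^sub>0 * D ^\<^sub>m (m + 2) + V m"
  unfolding U_def V_def by (rule msum_atLeast0LessThan_Suc, rule UV_term)+

text \<open>\<open>A\<close> times one summand equals the preceding summand times \<open>A\<close>.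
  In \<open>A * U m - U m * A\<close> only the two boundary terms survive; they are arranged so that
  no subtraction occurs.\<close>

private lemma A_U_telescope:
  "A * U m + D ^\<^sub>m Suc m * A\<^sub>0 * A ^\<^sub>m m * P = D * A\<^sub>0 * P + U m * A"
proof (induction m)
  case 0
  then show ?case using A A\<^sub>0 D P by (simp add: UV_0 assoc)
next
  case (Suc m)
  define T where "T = D ^\<^sub>m (m + 2) * A\<^sub>0 * A ^\<^sub>m m * P"
  have T: "T \<in> carrier_mat n n"
    unfolding T_def by (rule UV_term)
  have "A * T = A * D ^\<^sub>m Suc (Suc m) * A\<^sub>0 * A ^\<^sub>m m * P"
    unfolding T_def using A A\<^sub>0 D P by (simp add: assoc)
  then have AT: "A * T = D ^\<^sub>m Suc m * A\<^sub>0 * A ^\<^sub>m m * P"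
    unfolding A_powD .
  have "T * A = D ^\<^sub>m Suc (Suc m) * A\<^sub>0 * A ^\<^sub>m m * (A * P)"
    unfolding T_def proj using A A\<^sub>0 D P by (simp add: assoc)
  then have TA: "T * A = D ^\<^sub>m Suc (Suc m) * A\<^sub>0 * A ^\<^sub>m Suc m * P"
    using A A\<^sub>0 D P by (simp add: assoc)
  have "A * U (Suc m) + D ^\<^sub>m Suc (Suc m) * A\<^sub>0 * A ^\<^sub>m Suc m * P = (A * T + A * U m) + T * A"
    unfolding UV_Suc T_def[symmetric] TA[symmetric] using A T by (simp add: dist)
  also have "A * T + A * U m = D * A\<^sub>0 * P + U m * A"
    unfolding AT Suc[symmetric] using A A\<^sub>0 D P by (intro comm_add_mat[of _ n n]) (auto simp: assoc)
  also have "D * A\<^sub>0 * P + U m * A + T * A = D * A\<^sub>0 * P + U (Suc m) * A"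
    unfolding UV_Suc T_def[symmetric] add_mult_distrib_mat[OF T UV(1) A]
      comm_add_mat[OF mult_carrier_mat[OF T A] mult_carrier_mat[OF UV(1) A]]
    using A A\<^sub>0 D P T by (intro assoc_add_mat[of _ n n]) (auto simp: assoc)
  finally show ?case .
qed

text \<open>The mirror image of \<open>A_U_telescope\<close>, with \<open>P\<close> on the left and
  the powers of \<open>D\<close> on the right.\<close>

private lemma V_A_telescope:
  "V m * A + P * A ^\<^sub>m m * A\<^sub>0 * D ^\<^sub>m Suc m = P * A\<^sub>0 * D + A * V m"
proof (induction m)
  case 0
  then show ?case using A A\<^sub>0 D P by (simp add: UV_0 assoc)
next
  case (Suc m)
  define T where "T = P * A ^\<^sub>m m * A\<^sub>0 * D ^\<^sub>m (m + 2)"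
  have T: "T \<in> carrier_mat n n"
    unfolding T_def by (rule UV_term)
  have "T * A = P * A ^\<^sub>m m * A\<^sub>0 * (D ^\<^sub>m Suc (Suc m) * A)"
    unfolding T_def using A A\<^sub>0 D P by (simp add: assoc)
  then have TA: "T * A = P * A ^\<^sub>m m * A\<^sub>0 * D ^\<^sub>m Suc m"
    unfolding A_powD .
  have "A * T = (A * P) * A ^\<^sub>m m * A\<^sub>0 * D ^\<^sub>m Suc (Suc m)"
    unfolding T_def using A A\<^sub>0 D P by (simp add: assoc)
  also have "\<dots> = P * A ^\<^sub>m Suc m * A\<^sub>0 * D ^\<^sub>m Suc (Suc m)"
    unfolding proj pow_mat_Suc_left[OF A] using A A\<^sub>0 D P by (simp add: assoc)
  finally have AT: "A * T = P * A ^\<^sub>m Suc m * A\<^sub>0 * D ^\<^sub>m Suc (Suc m)" .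
  have "V (Suc m) * A + P * A ^\<^sub>m Suc m * A\<^sub>0 * D ^\<^sub>m Suc (Suc m) = (T * A + V m * A) + A * T"
    unfolding UV_Suc T_def[symmetric] AT[symmetric] using A T by (simp add: dist)
  also have "T * A + V m * A = P * A\<^sub>0 * D + A * V m"
    unfolding TA Suc[symmetric] using A A\<^sub>0 D P by (intro comm_add_mat[of _ n n]) (auto simp: assoc)
  also have "P * A\<^sub>0 * D + A * V m + A * T = P * A\<^sub>0 * D + A * V (Suc m)"
    unfolding UV_Suc T_def[symmetric] mult_add_distrib_mat[OF A T UV(2)]
      comm_add_mat[OF mult_carrier_mat[OF A T] mult_carrier_mat[OF A UV(2)]]
    using A A\<^sub>0 D P T by (intro assoc_add_mat[of _ n n]) (auto simp: assoc)
  finally show ?case .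
qed

text \<open>At length \<open>k\<close> the far boundary term contains
  \<open>A ^\<^sub>m k * P = 0\<^sub>m n n\<close>. Thus \<open>U k\<close> solves a Sylvester
  equation for \<open>A\<close>.\<close>

private lemma A_U: "A * U k = D * A\<^sub>0 * P + U k * A"
proof -
  have "D ^\<^sub>m Suc k * A\<^sub>0 * A ^\<^sub>m k * P = D ^\<^sub>m Suc k * A\<^sub>0 * (A ^\<^sub>m k * P)"
    using A A\<^sub>0 D P by (simp add: assoc)
  then have "D ^\<^sub>m Suc k * A\<^sub>0 * A ^\<^sub>m k * P = 0\<^sub>m n n"
    unfolding proj using A\<^sub>0 D by simp
  then show ?thesis
    using A_U_telescope[of k] A by (simp add: assoc)
qed

private lemma V_A: "V k * A = P * A\<^sub>0 * D + A * V k"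
proof -
  have "P * A ^\<^sub>m k * A\<^sub>0 * D ^\<^sub>m Suc k = 0\<^sub>m n n"
    unfolding powA_P[symmetric] proj using A\<^sub>0 D by simp
  then show ?thesis
    using V_A_telescope[of k] A by (simp add: assoc)
qed

text \<open>Every summand begins with a power of \<open>D\<close>, which \<open>A * D\<close> fixes,
  and ends with the idempotent \<open>P\<close>, which \<open>A * D\<close> annihilates.\<close>

private lemma U_absorb: "A * D * U m = U m" "U m * P = U m" "U m * (A * D) = 0\<^sub>m n n"
proof -
  show "A * D * U m = U m"
  proof (induction m)
    case (Suc m)
    have "A * D * (D ^\<^sub>m (m + 2) * A\<^sub>0 * A ^\<^sub>m m * P) = (A * D * D ^\<^sub>m Suc (Suc m)) * A\<^sub>0 * A ^\<^sub>m m * P"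
      using A A\<^sub>0 D P by (simp add: assoc)
    then have "A * D * (D ^\<^sub>m (m + 2) * A\<^sub>0 * A ^\<^sub>m m * P) = D ^\<^sub>m (m + 2) * A\<^sub>0 * A ^\<^sub>m m * P"
      unfolding E_powD by simp
    then show ?case
      unfolding UV_Suc mult_add_distrib_mat[OF AD UV_term(1) UV(1)] Suc by simp
  qed (use A D in \<open>simp add: UV_0\<close>)
  show UP: "U m * P = U m"
  proof (induction m)
    case (Suc m)
    have "D ^\<^sub>m (m + 2) * A\<^sub>0 * A ^\<^sub>m m * P * P = D ^\<^sub>m (m + 2) * A\<^sub>0 * A ^\<^sub>m m * (P * P)"
      using A A\<^sub>0 D P by (simp add: assoc)
    then have "D ^\<^sub>m (m + 2) * A\<^sub>0 * A ^\<^sub>m m * P * P = D ^\<^sub>m (m + 2) * A\<^sub>0 * A ^\<^sub>m m * P"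
      unfolding proj .
    then show ?case
      unfolding UV_Suc add_mult_distrib_mat[OF UV_term(1) UV(1) P] Suc by simp
  qed (use P in \<open>simp add: UV_0\<close>)
  have "U m * (A * D) = U m * P * (D * A)"
    unfolding UP comm ..
  also have "\<dots> = U m * (P * D) * A"
    using A D P by (simp add: assoc)
  finally show "U m * (A * D) = 0\<^sub>m n n"
    unfolding proj using A by simp
qed

private lemma V_absorb: "V m * (A * D) = V m" "P * V m = V m" "A * D * V m = 0\<^sub>m n n"
proof -
  show "V m * (A * D) = V m"
  proof (induction m)
    case (Suc m)
    have "P * A ^\<^sub>m m * A\<^sub>0 * D ^\<^sub>m (m + 2) * (A * D) = P * A ^\<^sub>m m * A\<^sub>0 * (D ^\<^sub>m Suc (Suc m) * (A * D))"
      using A A\<^sub>0 D P by (simp add: assoc)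
    then have "P * A ^\<^sub>m m * A\<^sub>0 * D ^\<^sub>m (m + 2) * (A * D) = P * A ^\<^sub>m m * A\<^sub>0 * D ^\<^sub>m (m + 2)"
      unfolding E_powD by simp
    then show ?case
      unfolding UV_Suc add_mult_distrib_mat[OF UV_term(2) UV(2) AD] Suc by simp
  qed (use A D in \<open>simp add: UV_0\<close>)
  show PV: "P * V m = V m"
  proof (induction m)
    case (Suc m)
    have "P * (P * A ^\<^sub>m m * A\<^sub>0 * D ^\<^sub>m (m + 2)) = P * P * A ^\<^sub>m m * A\<^sub>0 * D ^\<^sub>m (m + 2)"
      using A A\<^sub>0 D P by (simp add: assoc)
    then have "P * (P * A ^\<^sub>m m * A\<^sub>0 * D ^\<^sub>m (m + 2)) = P * A ^\<^sub>m m * A\<^sub>0 * D ^\<^sub>m (m + 2)"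
      unfolding proj .
    then show ?case
      unfolding UV_Suc mult_add_distrib_mat[OF P UV_term(2) UV(2)] Suc by simp
  qed (use P in \<open>simp add: UV_0\<close>)
  have "A * D * V m = A * D * (P * V m)"
    unfolding PV ..
  also have "\<dots> = A * (D * P) * V m"
    using A D P by (simp add: assoc)
  finally show "A * D * V m = 0\<^sub>m n n"
    unfolding proj using A by simp
qed

text \<open>The commutator with \<open>U k\<close> is a derivation. Since \<open>D\<close> and
  \<open>P\<close> commute with \<open>A\<close>, its value on \<open>A\<close> given by
  \<open>A_U\<close> propagates to powers by the recursion that defines the growth of
  \<open>pow_deriv\<close>.\<close>

private lemma powA_U: "A ^\<^sub>m j * U k = D * pow_deriv n A A\<^sub>0 j * P + U k * A ^\<^sub>m j"
proof (induction j)
  case 0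
  then show ?case using A D P by (simp add: pow_deriv_def msum_empty)
next
  case (Suc j)
  let ?S = "pow_deriv n A A\<^sub>0 j"
  have S: "?S \<in> carrier_mat n n"
    using A A\<^sub>0 by simp
  have "A ^\<^sub>m Suc j * U k = A * (A ^\<^sub>m j * U k)"
    unfolding pow_mat_Suc_left[OF A] using A by (simp add: assoc)
  also have "\<dots> = A * D * ?S * P + (A * U k) * A ^\<^sub>m j"
    unfolding Suc using A D P S by (simp add: dist assoc)
  also have "\<dots> = D * A * ?S * P + (D * A\<^sub>0 * (P * A ^\<^sub>m j) + U k * A ^\<^sub>m Suc j)"
    unfolding A_U comm pow_mat_Suc_left[OF A] using A A\<^sub>0 D P by (simp add: dist assoc)
  also have "\<dots> = D * (A * ?S + A\<^sub>0 * A ^\<^sub>m j) * P + U k * A ^\<^sub>m Suc j"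
    unfolding powA_P[symmetric] using A A\<^sub>0 D P S by (simp add: dist assoc)
  finally show ?case
    unfolding pow_deriv_Suc[OF A A\<^sub>0] .
qed

text \<open>The standard parts of the three equations are those for \<open>D\<close>. The
  infinitesimal parts are the facts \<open>1\<close> (commutation), \<open>2\<close> (the equation
  for \<open>X * A * X\<close>) and \<open>3\<close> (the exponent equation); the hypothesis
  \<open>zero\<close> enters in \<open>3\<close>.\<close>

lemma is_drazin_dual:
  assumes zero: "P * pow_deriv n A A\<^sub>0 k * P = 0\<^sub>m n n"
  shows "is_drazin k (dual_mat A A\<^sub>0) (dual_mat D
    (- (D * A\<^sub>0 * D)
      + msum n (\<lambda>i. D ^\<^sub>m (i + 2) * A\<^sub>0 * A ^\<^sub>m i * P) {0..<k}
      + msum n (\<lambda>i. P * A ^\<^sub>m i * A\<^sub>0 * D ^\<^sub>m (i + 2)) {0..<k}))"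
proof -
  define R where "R = - (D * A\<^sub>0 * D) + U k + V k"
  have R: "R \<in> carrier_mat n n"
    unfolding R_def using A\<^sub>0 D by (simp add: assoc)
  let ?S = "pow_deriv n A A\<^sub>0 k"
  have S: "?S \<in> carrier_mat n n"
    using A A\<^sub>0 by simp
  have neg: "D * A\<^sub>0 * D \<in> carrier_mat n n" "- (D * A\<^sub>0 * D) \<in> carrier_mat n n"
    using A\<^sub>0 D by (auto simp: assoc)
  have AR: "A * R = - (A * (D * A\<^sub>0 * D)) + A * U k + A * V k"
    unfolding R_def using A neg by (simp add: dist assoc)
  have RA: "R * A = - (D * A\<^sub>0 * D * A) + U k * A + V k * A"
    unfolding R_def using A neg by (simp add: dist assoc)
  \<comment> \<open>The commutators of \<open>A\<close> with \<open>U k\<close> and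
    \<open>V k\<close> contribute \<open>D * A\<^sub>0 * P\<close> and
    \<open>P * A\<^sub>0 * D\<close>. Expanding \<open>P\<close>, the parts with
    \<open>A * D\<close> cancel those from \<open>- (D * A\<^sub>0 * D)\<close>.\<close>
  have 1: "A * R + A\<^sub>0 * D = D * A\<^sub>0 + R * A"
  proof -
    have DP: "D * A\<^sub>0 * P = D * A\<^sub>0 - D * A\<^sub>0 * (A * D)" and PD: "P * A\<^sub>0 * D = A\<^sub>0 * D - A * D * A\<^sub>0 * D"
      unfolding P_def using A A\<^sub>0 D by (simp_all add: dist assoc)
    have e: "D * A\<^sub>0 * D * A = D * A\<^sub>0 * (A * D)" "A * (D * A\<^sub>0 * D) = A * D * A\<^sub>0 * D"
      using A A\<^sub>0 D by (simp_all add: assoc comm[symmetric])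
    show ?thesis
      unfolding AR RA A_U V_A DP PD e using A A\<^sub>0 D
      by (intro eq_matI) (auto simp: assoc simp del: index_mult_mat(1))
  qed
  \<comment> \<open>Multiplication by \<open>D * A\<close> on the left keeps \<open>U k\<close> and
    kills \<open>V k\<close>, on the right the reverse; the surplus copy of
    \<open>- (D * A\<^sub>0 * D)\<close> is offset by the remaining term.\<close>
  have 2: "D * A * R + (D * A\<^sub>0 + R * A) * D = R"
  proof -
    have "D * A * R = - (D * A * (D * A\<^sub>0 * D)) + D * A * U k + D * A * V k"
      unfolding R_def using A D neg by (simp add: dist assoc)
    also have "D * A * (D * A\<^sub>0 * D) = D * A * D * A\<^sub>0 * D"
      using A A\<^sub>0 D by (simp add: assoc)
    finally have DAR: "D * A * R = - (D * A\<^sub>0 * D) + U k + 0\<^sub>m n n"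
      unfolding DAD unfolding comm[symmetric] U_absorb V_absorb .
    have "(D * A\<^sub>0 + R * A) * D = D * A\<^sub>0 * D + R * (A * D)"
      using A A\<^sub>0 D R by (simp add: dist assoc)
    also have "R * (A * D) = - (D * A\<^sub>0 * D * (A * D)) + U k * (A * D) + V k * (A * D)"
      unfolding R_def using neg AD by (simp add: dist assoc)
    also have "D * A\<^sub>0 * D * (A * D) = D * A\<^sub>0 * (D * A * D)"
      using A A\<^sub>0 D by (simp add: assoc)
    finally have RAD: "(D * A\<^sub>0 + R * A) * D = D * A\<^sub>0 * D + (- (D * A\<^sub>0 * D) + 0\<^sub>m n n + V k)"
      unfolding DAD U_absorb V_absorb .
    show ?thesis
      unfolding DAR RAD unfolding R_def
      by (intro eq_matI) (simp_all del: index_mult_mat(1))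
  qed
  have 3: "A ^\<^sub>m k * (D * A\<^sub>0 + R * A) + ?S * (D * A) = ?S"
  proof -
    have kU: "A ^\<^sub>m k * U k = D * ?S * P"
    proof -
      have "U k * A ^\<^sub>m k = U k * P * A ^\<^sub>m k"
        unfolding U_absorb ..
      also have "\<dots> = U k * (P * A ^\<^sub>m k)"
        using A P by (simp add: assoc)
      finally have "U k * A ^\<^sub>m k = 0\<^sub>m n n"
        unfolding powA_P[symmetric] proj by simp
      then show ?thesis
        unfolding powA_U using D P S by (simp add: assoc)
    qed
    have kAU: "A ^\<^sub>m k * (A * U k) = A * D * ?S * P"
    proof -
      have "A ^\<^sub>m k * (A * U k) = A ^\<^sub>m Suc k * U k"
        using A by (simp add: assoc)
      also have "\<dots> = A * (A ^\<^sub>m k * U k)"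
        unfolding pow_mat_Suc_left[OF A] using A by (simp add: assoc)
      finally show ?thesis
        unfolding kU using A D P S by (simp add: assoc)
    qed
    have kAV: "A ^\<^sub>m k * (A * V k) = 0\<^sub>m n n"
    proof -
      have "A ^\<^sub>m k * (A * V k) = A ^\<^sub>m Suc k * (P * V k)"
        unfolding V_absorb using A by (simp add: assoc)
      also have "\<dots> = A * (A ^\<^sub>m k * P) * V k"
        unfolding pow_mat_Suc_left[OF A] using A P by (simp add: assoc)
      finally show ?thesis
        unfolding proj using A by simp
    qed
    have kAD: "A ^\<^sub>m k * (A * (D * A\<^sub>0 * D)) = A ^\<^sub>m k * (A\<^sub>0 * D)"
    proof -
      have "A ^\<^sub>m k * (A * (D * A\<^sub>0 * D)) = A ^\<^sub>m k * (A * D) * (A\<^sub>0 * D)"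
        using A A\<^sub>0 D by (simp add: assoc)
      also have "A ^\<^sub>m k * (A * D) = A ^\<^sub>m k * D * A"
        unfolding comm using A D by (simp add: assoc)
      finally show ?thesis
        unfolding eqk .
    qed
    have "A ^\<^sub>m k * (D * A\<^sub>0 + R * A)
        = - (A ^\<^sub>m k * (A * (D * A\<^sub>0 * D))) + A ^\<^sub>m k * (A * U k) + A ^\<^sub>m k * (A * V k)
          + A ^\<^sub>m k * (A\<^sub>0 * D)"
      unfolding 1[symmetric] AR using A A\<^sub>0 D neg by (simp add: dist assoc)
    also have "\<dots> = A * D * ?S * P"
      unfolding kAU kAV kAD using A A\<^sub>0 D P S
      by (intro eq_matI) (auto simp: assoc simp del: index_mult_mat(1))
    \<comment> \<open>The hypothesis allows the missing block \<open>P * ?S * P\<close> to be added,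
      so that \<open>A * D + P\<close> collapses to the identity.\<close>
    also have "\<dots> = A * D * ?S * P + P * ?S * P"
      unfolding zero using A D P S by (simp add: assoc)
    also have "\<dots> = (A * D + P) * ?S * P"
      using AD P S by (simp add: dist assoc)
    also have "\<dots> = ?S * P"
      unfolding proj using S by simp
    also have "\<dots> = ?S - ?S * (D * A)"
      unfolding P_def comm[symmetric] using AD S by (simp add: dist)
    finally show ?thesis
      using A D S by (intro eq_matI) (auto simp: assoc simp del: index_mult_mat(1))
  qed
  have "dual_mat A A\<^sub>0 * dual_mat D R = dual_mat (A * D) (A * R + A\<^sub>0 * D)"
    by (rule dual_mat_mult[OF A A\<^sub>0 D R])
  moreover have DA: "dual_mat D R * dual_mat A A\<^sub>0 = dual_mat (D * A) (D * A\<^sub>0 + R * A)"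
    by (rule dual_mat_mult[OF D R A A\<^sub>0])
  moreover have "dual_mat D R * dual_mat A A\<^sub>0 * dual_mat D R = dual_mat D R"
  proof -
    have "D * A\<^sub>0 + R * A \<in> carrier_mat n n"
      using A A\<^sub>0 D R by (simp add: assoc)
    then show ?thesis
      unfolding DA by (simp only: dual_mat_mult[OF mult_carrier_mat[OF D A] _ D R] DAD 2)
  qed
  moreover have "dual_mat A A\<^sub>0 ^\<^sub>m k * dual_mat D R * dual_mat A A\<^sub>0 = dual_mat A A\<^sub>0 ^\<^sub>m k"
  proof -
    have "dual_mat A A\<^sub>0 ^\<^sub>m k * dual_mat D R * dual_mat A A\<^sub>0
        = dual_mat A A\<^sub>0 ^\<^sub>m k * dual_mat (D * A) (D * A\<^sub>0 + R * A)"
      unfolding DA[symmetric] using A A\<^sub>0 D R by (simp add: assoc)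
    also have "\<dots> = dual_mat (A ^\<^sub>m k * (D * A)) (A ^\<^sub>m k * (D * A\<^sub>0 + R * A) + ?S * (D * A))"
      unfolding dual_mat_pow[OF A A\<^sub>0] using A A\<^sub>0 D R S by (intro dual_mat_mult[of _ n n _ _ n]) (simp_all add: assoc)
    also have "A ^\<^sub>m k * (D * A) = A ^\<^sub>m k"
      using eqk A D by (simp add: assoc)
    finally show ?thesis
      unfolding 3 dual_mat_pow[OF A A\<^sub>0] .
  qed
  ultimately show ?thesis
    unfolding U_def[symmetric] V_def[symmetric] R_def[symmetric] is_drazin_def using A A\<^sub>0 D R 1 comm by simp
qed

end

lemma is_drazin_dual_DC_z:
  assumes "dual_mat A A\<^sub>0 \<in> DC_z n" and A: "A \<in> carrier_mat n n" and A\<^sub>0: "A\<^sub>0 \<in> carrier_mat n n"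
    and D: "D = drazin_inv A"
  shows "is_drazin (mat_Ind A) (dual_mat A A\<^sub>0) (dual_mat D
    (- (D * A\<^sub>0 * D)
      + msum n (\<lambda>i. D ^\<^sub>m (i + 2) * A\<^sub>0 * A ^\<^sub>m i * (1\<^sub>m n - A * D)) {0..<mat_Ind A}
      + msum n (\<lambda>i. (1\<^sub>m n - A * D) * A ^\<^sub>m i * A\<^sub>0 * D ^\<^sub>m (i + 2)) {0..<mat_Ind A}))"
proof (rule is_drazin_dual[OF A A\<^sub>0 _ refl])
  show "is_drazin (mat_Ind A) A D"
    unfolding D by (rule is_drazin_drazin_inv[OF A])
  show "(1\<^sub>m n - A * D) * pow_deriv n A A\<^sub>0 (mat_Ind A) * (1\<^sub>m n - A * D) = 0\<^sub>m n n"
    using assms(1) unfolding DC_z_def pow_deriv_def Let_def mem_Collect_eq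
      std_inf_dual_mat[OF A A\<^sub>0] D by simp
qed

text \<open>Membership in \<open>DC_z\<close> provides a solution whose exponent is the index, so
  the \<open>THE\<close> in the definition denotes it; uniqueness across exponents then identifies
  it with \<open>X\<close>, whatever \<open>j\<close> is.\<close>

lemma dual_drazin_inv_eqI:
  assumes DC: "Mh \<in> DC_z n" and X: "is_drazin j Mh X"
  shows "dual_drazin_inv Mh = X"
proof -
  have Mh: "Mh \<in> carrier_mat n n"
    using DC unfolding DC_z_def by simp
  obtain Y where Y: "is_drazin (Ind_s Mh) Mh Y"
    using is_drazin_dual_DC_z[of "std_mat Mh" "inf_mat Mh" n] DC Mh
    by (auto simp: dual_mat_std_inf Ind_s_def)
  have "dual_drazin_inv Mh = Y"
    unfolding dual_drazin_inv_def using Y drazin_unique[OF Mh] by blast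
  then show ?thesis
    using drazin_unique[OF Mh Y X] by simp
qed

section \<open>Bordered matrices\<close>

lemma mult_block_diag_mat:
  fixes A\<^sub>1 :: "'a :: semiring_1 mat"
  assumes A: "A\<^sub>1 \<in> carrier_mat a b" "A\<^sub>2 \<in> carrier_mat b e"
    and F: "F\<^sub>1 \<in> carrier_mat c d" "F\<^sub>2 \<in> carrier_mat d h"
  shows "four_block_mat A\<^sub>1 (0\<^sub>m a d) (0\<^sub>m c b) F\<^sub>1 * four_block_mat A\<^sub>2 (0\<^sub>m b h) (0\<^sub>m d e) F\<^sub>2
    = four_block_mat (A\<^sub>1 * A\<^sub>2) (0\<^sub>m a h) (0\<^sub>m c e) (F\<^sub>1 * F\<^sub>2)"
  unfolding mult_four_block_mat[OF A(1) zero_carrier_mat zero_carrier_mat F(1)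
      A(2) zero_carrier_mat zero_carrier_mat F(2)]
  by (simp only: left_mult_zero_mat[OF A(2)] right_mult_zero_mat[OF A(1)] left_mult_zero_mat[OF F(2)]
      right_mult_zero_mat[OF F(1)] left_mult_zero_mat[OF zero_carrier_mat] zero_carrier_mat
      left_add_zero_mat[of _ c h] right_add_zero_mat[of _ a e] left_add_zero_mat[of _ c e]
      left_add_zero_mat[of _ a h] mult_carrier_mat[OF A] mult_carrier_mat[OF F])

text \<open>With compatible inner dimensions, block-diagonal matrices multiply blockwise; the
  induction peels off the first block.\<close>

lemma diag_block_mat_mult_eq_zero:
  fixes f g :: "'i \<Rightarrow> 'a :: semiring_1 mat"
  assumes "\<And>i. i \<in> set is \<Longrightarrow> dim_col (f i) = dim_row (g i)"
    and "\<And>i. i \<in> set is \<Longrightarrow> f i * g i = 0\<^sub>m (dim_row (f i)) (dim_col (g i))"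
  shows "diag_block_mat (map f is) * diag_block_mat (map g is)
    = 0\<^sub>m (dim_row (diag_block_mat (map f is))) (dim_col (diag_block_mat (map g is)))"
  using assms
proof (induction "is")
  case (Cons i "is")
  let ?F = "diag_block_mat (map f is)" and ?G = "diag_block_mat (map g is)"
  have IH: "?F * ?G = 0\<^sub>m (dim_row ?F) (dim_col ?G)"
    by (rule Cons.IH) (use Cons.prems in auto)
  have eq: "dim_col ?F = dim_row ?G"
    unfolding dim_diag_block_mat using Cons.prems(1) by (auto intro!: arg_cong[where f = sum_list])
  have i: "dim_col (f i) = dim_row (g i)" "f i * g i = 0\<^sub>m (dim_row (f i)) (dim_col (g i))"
    using Cons.prems by auto
  define a b c d where "a = dim_row (f i)" and "b = dim_row (g i)"
    and "c = dim_row ?F" and "d = dim_row ?G"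
  have carrier: "f i \<in> carrier_mat a b" "g i \<in> carrier_mat b (dim_col (g i))"
    "?F \<in> carrier_mat c d" "?G \<in> carrier_mat d (dim_col ?G)"
    unfolding a_def b_def c_def d_def using i(1) eq by (metis carrier_matI)+
  show ?case
    using mult_block_diag_mat[OF carrier]
    unfolding i(2) IH list.map diag_block_mat.simps Let_def i(1) eq
    unfolding a_def b_def c_def d_def by simp
qed simp

context
  includes square_mat_simps
  fixes A X B C :: "'a :: comm_ring_1 mat" and n m k :: nat
  assumes A: "A \<in> carrier_mat n n" and X: "is_drazin k A X"
    and B: "B \<in> carrier_mat n m" and C: "C \<in> carrier_mat m n" and BC: "B * C = 0\<^sub>m n n"
begin

private lemma X_carrier: "X \<in> carrier_mat n n" and powA_X_A: "A ^\<^sub>m k * X * A = A ^\<^sub>m k"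
  and XAX: "X * A * X = X" and AX_comm: "A * X = X * A"
  using A X unfolding is_drazin_def by auto

private lemmas block_dims [simp] = A[THEN carrier_matD(1)] A[THEN carrier_matD(2)]
  X_carrier[THEN carrier_matD(1)] X_carrier[THEN carrier_matD(2)]
  B[THEN carrier_matD(1)] B[THEN carrier_matD(2)] C[THEN carrier_matD(1)] C[THEN carrier_matD(2)]

private lemmas block_carrier = A X_carrier B C pow_carrier_mat[OF A]
  mult_carrier_mat[of _ n n _ n] mult_carrier_mat[of _ n n _ m]
  mult_carrier_mat[of _ m n _ n] mult_carrier_mat[of _ m n _ m]

private lemmas block_assoc = assoc_mult_mat[of _ n n _ n _ n] assoc_mult_mat[of _ n n _ n _ m]
  assoc_mult_mat[of _ m n _ n _ n] assoc_mult_mat[of _ m n _ n _ m]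
  assoc_mult_mat[of _ n n _ m _ n] assoc_mult_mat[of _ n n _ m _ m]
  assoc_mult_mat[of _ m n _ m _ n] assoc_mult_mat[of _ m n _ m _ m]

private lemma BC_left: "Z \<in> carrier_mat n l \<Longrightarrow> B * (C * Z) = 0\<^sub>m n l"
  using assoc_mult_mat[OF B C, of Z l] unfolding BC by simp

private lemma AX_left: "Z \<in> carrier_mat n l \<Longrightarrow> A * (X * Z) = X * (A * Z)"
  using assoc_mult_mat[OF A X_carrier, of Z l] assoc_mult_mat[OF X_carrier A, of Z l] AX_comm by simp

private lemma XXA: "X * (X * A) = X"
  using assoc_mult_mat[OF X_carrier A X_carrier] XAX unfolding AX_comm by simp

private lemma XXA_left:
  assumes "Z \<in> carrier_mat n l"
  shows "X * (X * (A * Z)) = X * Z"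
proof -
  have "X * (X * (A * Z)) = X * (X * A) * Z"
    using assms assoc_mult_mat[OF X_carrier A assms] X_carrier A
      assoc_mult_mat[OF X_carrier mult_carrier_mat[OF X_carrier A] assms] by simp
  then show ?thesis unfolding XXA .
qed

private lemma eqk_left:
  assumes "Z \<in> carrier_mat n l"
  shows "A ^\<^sub>m k * (X * (A * Z)) = A ^\<^sub>m k * Z"
proof -
  have "A ^\<^sub>m k * (X * (A * Z)) = A ^\<^sub>m k * X * A * Z"
    using assoc_mult_mat[OF pow_carrier_mat[OF A] X_carrier mult_carrier_mat[OF A assms], of k]
      assoc_mult_mat[OF mult_carrier_mat[OF pow_carrier_mat[OF A] X_carrier] A assms, of k] by simp
  then show ?thesis unfolding powA_X_A .
qed

text \<open>A rewrite system for right-nested words: \<open>A\<close> moves right past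
  \<open>X\<close>, \<open>X * (X * A)\<close> shrinks to \<open>X\<close>, and \<open>B * C\<close>
  vanishes. Each rule also has a form with a tail \<open>Z\<close>, with \<open>n\<close> or
  \<open>m\<close> columns, so that it applies inside longer words.\<close>

private lemmas normalize = AX_comm AX_left[where l = n] AX_left[where l = m] XXA
  XXA_left[where l = n] XXA_left[where l = m] eqk_left[where l = n] eqk_left[where l = m]
  BC BC_left[where l = n] BC_left[where l = m] block_carrier block_assoc

text \<open>As \<open>B * C\<close> vanishes, a surviving word has \<open>C\<close> only at its
  start and \<open>B\<close> only at its end. The lower right block spends two factors on the
  borders, hence the shift by 2.\<close>

private lemma bordered_pow:
  "four_block_mat A B C (0\<^sub>m m m) ^\<^sub>m (j + 2) = four_block_mat (A ^\<^sub>m (j + 2)) (A ^\<^sub>m (j + 1) * B)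
    (C * A ^\<^sub>m (j + 1)) (C * A ^\<^sub>m j * B)"
proof (induction j)
  case 0
  have "four_block_mat A B C (0\<^sub>m m m) * four_block_mat A B C (0\<^sub>m m m)
    = four_block_mat (A * A) (A * B) (C * A) (C * B)"
    by (subst mult_four_block_mat[of _ n n _ m _ m _ _ n _ m]) (simp_all add: normalize)
  then show ?case
    by (simp add: numeral_2_eq_2 normalize)
next
  case (Suc j)
  show ?case
    unfolding add_Suc pow_mat.simps(2)[of _ "j + 2"] Suc
    by (subst mult_four_block_mat[of _ n n _ m _ m _ _ n _ m]) (simp_all add: normalize)
qed

text \<open>The exponent \<open>k + 2\<close> guarantees a factor \<open>A ^\<^sub>m k\<close> in
  every block of the power, also in the lower right one, so the exponent equation for
  \<open>A\<close> applies blockwise.\<close>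

lemma is_drazin_bordered:
  "is_drazin (k + 2) (four_block_mat A B C (0\<^sub>m m m))
    (four_block_mat X (X ^\<^sub>m 2 * B) (C * X ^\<^sub>m 2) (C * X ^\<^sub>m 3 * B))"
proof -
  let ?M = "four_block_mat A B C (0\<^sub>m m m)"
  let ?Y = "four_block_mat X (X * (X * B)) (C * (X * X)) (C * (X * (X * (X * B))))"
  \<comment> \<open>The common value of \<open>?M * ?Y\<close> and \<open>?Y * ?M\<close>; the other
    two equations are checked by multiplying with it.\<close>
  let ?E = "four_block_mat (A * X) (X * B) (C * X) (C * (X * (X * B)))"
  have Y: "four_block_mat X (X ^\<^sub>m 2 * B) (C * X ^\<^sub>m 2) (C * X ^\<^sub>m 3 * B) = ?Y"
    by (simp add: numeral_2_eq_2 numeral_3_eq_3 block_carrier block_assoc)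
  have M: "?M \<in> carrier_mat (n + m) (n + m)" and Yc: "?Y \<in> carrier_mat (n + m) (n + m)"
    by (rule four_block_carrier_mat; simp add: block_carrier)+
  have MY: "?M * ?Y = ?E"
    by (subst mult_four_block_mat[of _ n n _ m _ m _ _ n _ m]) (simp_all add: normalize)
  have YM: "?Y * ?M = ?E"
    by (subst mult_four_block_mat[of _ n n _ m _ m _ _ n _ m]) (simp_all add: normalize)
  have YE: "?Y * ?E = ?Y"
    by (subst mult_four_block_mat[of _ n n _ m _ m _ _ n _ m]) (simp_all add: normalize)
  have ME: "?M ^\<^sub>m (k + 2) * ?E = ?M ^\<^sub>m (k + 2)"
    unfolding bordered_pow
    by (subst mult_four_block_mat[of _ n n _ m _ m _ _ n _ m]) (simp_all add: normalize)
  have "?M ^\<^sub>m (k + 2) * ?Y * ?M = ?M ^\<^sub>m (k + 2)"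
    unfolding assoc_mult_mat[OF pow_carrier_mat[OF M] Yc M] YM by (rule ME)
  moreover have "?Y * ?M * ?Y = ?Y"
    unfolding assoc_mult_mat[OF Yc M Yc] MY by (rule YE)
  ultimately show ?thesis
    unfolding Y is_drazin_def using M Yc MY YM by simp
qed

end

section \<open>Diagonal borders over the dual numbers\<close>

text \<open>Identifies the orthogonality expression of the theorem as a scalar product over the dual
  numbers.\<close>

lemma dual_vec_scalar_prod:
  assumes "x \<in> carrier_vec n" "x' \<in> carrier_vec n" "y \<in> carrier_vec n" "y' \<in> carrier_vec n"
  shows "dual_vec x x' \<bullet> dual_vec y y' = dual_of (x \<bullet> y) + eps * dual_of (x \<bullet> y' + x' \<bullet> y)"
proof -
  have "dual_vec x x' \<bullet> dual_vec y y'
      = (\<Sum>l\<in>{0..<n}. Dual (x $ l) (x' $ l) * Dual (y $ l) (y' $ l))"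
    using assms by (simp add: scalar_prod_def dual_vec_def Dual_eq)
  also have "\<dots> = Dual (x \<bullet> y) (x \<bullet> y' + x' \<bullet> y)"
    using assms by (simp add: times_dual_complex_def Dual_sum scalar_prod_def sum.distrib)
  finally show ?thesis
    by (simp add: Dual_eq)
qed

lemma dual_mat_power_2_3:
  assumes D: "D \<in> carrier_mat n n" and R: "R \<in> carrier_mat n n"
  shows "dual_mat D R ^\<^sub>m 2 = dual_mat (D ^\<^sub>m 2) (D * R + R * D)"
    and "dual_mat D R ^\<^sub>m 3 = dual_mat (D ^\<^sub>m 3) (D ^\<^sub>m 2 * R + D * R * D + R * D ^\<^sub>m 2)"
proof -
  note assoc = square_assoc[where n = n]
  have DD: "D * D \<in> carrier_mat n n" and DR: "D * R + R * D \<in> carrier_mat n n"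
    using D R by (simp_all add: assoc)
  have 2: "dual_mat D R ^\<^sub>m 2 = dual_mat (D * D) (D * R + R * D)"
    using dual_mat_mult[OF D R D R] D R by (simp add: numeral_2_eq_2)
  then show "dual_mat D R ^\<^sub>m 2 = dual_mat (D ^\<^sub>m 2) (D * R + R * D)"
    using D by (simp add: numeral_2_eq_2)
  have "dual_mat D R ^\<^sub>m 3 = dual_mat D R ^\<^sub>m 2 * dual_mat D R"
    by (simp add: numeral_2_eq_2 numeral_3_eq_3)
  also have "\<dots> = dual_mat (D * D * D) (D * D * R + (D * R + R * D) * D)"
    unfolding 2 by (rule dual_mat_mult[OF DD DR D R])
  also have "D * D * R + (D * R + R * D) * D = D ^\<^sub>m 2 * R + D * R * D + R * D ^\<^sub>m 2"
  proof -
    have "(D * R + R * D) * D = D * R * D + R * (D * D)"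
      using D R add_mult_distrib_mat[of "D * R" n n "R * D" D n] by (simp add: assoc)
    moreover have "D ^\<^sub>m 2 = D * D"
      using D by (simp add: numeral_2_eq_2)
    ultimately show ?thesis
      using D R assoc_add_mat[of "D * D * R" n n "D * R * D" "R * (D * D)"] by (simp add: assoc)
  qed
  also have "D * D * D = D ^\<^sub>m 3"
    using D by (simp add: numeral_3_eq_3)
  finally show "dual_mat D R ^\<^sub>m 3 = dual_mat (D ^\<^sub>m 3) (D ^\<^sub>m 2 * R + D * R * D + R * D ^\<^sub>m 2)" .
qed

lemma dual_mat_zero: "dual_mat (0\<^sub>m nr nc) (0\<^sub>m nr nc) = 0\<^sub>m nr nc"
  by (intro eq_matI) (auto simp: dual_mat_def zero_dual_complex_def simp flip: Dual_eq)

section \<open>Border matrices and their product\<close>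

lemma border_carrier:
  "diag_block_mat (map (\<lambda>i. mat_of_rows (r i) [v i]) [0..<n]) \<in> carrier_mat n (\<Sum>i<n. r i)"
  "diag_block_mat (map (\<lambda>i. mat_of_cols (r i) [v i]) [0..<n]) \<in> carrier_mat (\<Sum>i<n. r i) n"
  by (auto intro!: carrier_matI simp: dim_diag_block_mat o_def sum_list_triv
      interv_sum_list_conv_sum_set_nat atLeast0LessThan)

text \<open>Each pair of blocks is a row times a column, whose product is a 1 by 1 matrix holding
  the scalar product.\<close>

lemma border_mult_eq_zero:
  fixes v w :: "nat \<Rightarrow> 'a :: comm_ring_1 vec"
  assumes v: "\<And>i. i < n \<Longrightarrow> v i \<in> carrier_vec (r i)" and w: "\<And>i. i < n \<Longrightarrow> w i \<in> carrier_vec (r i)"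
    and orth: "\<And>i. i < n \<Longrightarrow> v i \<bullet> w i = 0"
  shows "diag_block_mat (map (\<lambda>i. mat_of_rows (r i) [v i]) [0..<n])
    * diag_block_mat (map (\<lambda>i. mat_of_cols (r i) [w i]) [0..<n]) = 0\<^sub>m n n"
proof -
  let ?B = "diag_block_mat (map (\<lambda>i. mat_of_rows (r i) [v i]) [0..<n])"
    and ?C = "diag_block_mat (map (\<lambda>i. mat_of_cols (r i) [w i]) [0..<n])"
  have "?B * ?C = 0\<^sub>m (dim_row ?B) (dim_col ?C)"
  proof (rule diag_block_mat_mult_eq_zero)
    fix i assume "i \<in> set [0..<n]"
    then show "mat_of_rows (r i) [v i] * mat_of_cols (r i) [w i]
        = 0\<^sub>m (dim_row (mat_of_rows (r i) [v i])) (dim_col (mat_of_cols (r i) [w i]))"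
      using v w orth by (intro eq_matI) auto
  qed simp
  then show ?thesis
    unfolding carrier_matD(1)[OF border_carrier(1)] carrier_matD(2)[OF border_carrier(2)] .
qed

text \<open>The product rule for the blocks of the bordered inverse. \<open>D\<close> and
  \<open>R\<close> need not commute, so the derivatives of the second and third powers list every
  position of \<open>R\<close>.\<close>

lemma four_block_bordered_dual:
  includes square_mat_simps
  assumes D: "D \<in> carrier_mat n n" and R: "R \<in> carrier_mat n n"
    and B: "B \<in> carrier_mat n m" and B\<^sub>0: "B\<^sub>0 \<in> carrier_mat n m"
    and C: "C \<in> carrier_mat m n" and C\<^sub>0: "C\<^sub>0 \<in> carrier_mat m n"
  shows "four_block_mat (dual_mat D R) (dual_mat D R ^\<^sub>m 2 * dual_mat B B\<^sub>0)
      (dual_mat C C\<^sub>0 * dual_mat D R ^\<^sub>m 2) (dual_mat C C\<^sub>0 * dual_mat D R ^\<^sub>m 3 * dual_mat B B\<^sub>0)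
    = dual_mat
        (four_block_mat D (D ^\<^sub>m 2 * B) (C * D ^\<^sub>m 2) (C * D ^\<^sub>m 3 * B))
        (four_block_mat R (D ^\<^sub>m 2 * B\<^sub>0 + D * R * B + R * D * B)
          (C * D * R + C * R * D + C\<^sub>0 * D ^\<^sub>m 2)
          (C * D ^\<^sub>m 3 * B\<^sub>0 + C * D ^\<^sub>m 2 * R * B + C\<^sub>0 * D ^\<^sub>m 3 * B
            + C * D * R * D * B + C * R * D ^\<^sub>m 2 * B))"
proof -
  let ?R\<^sub>2 = "D * R + R * D" and ?R\<^sub>3 = "D ^\<^sub>m 2 * R + D * R * D + R * D ^\<^sub>m 2"
  note D2 = pow_carrier_mat[OF D, of 2] and D3 = pow_carrier_mat[OF D, of 3]
  have R2: "?R\<^sub>2 \<in> carrier_mat n n" and R3: "?R\<^sub>3 \<in> carrier_mat n n"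
    using D D2 R by (simp_all add: square_assoc[where n = n])
  note carrier = D R B B\<^sub>0 C C\<^sub>0 D2 D3
    mult_carrier_mat[of _ n n _ n] mult_carrier_mat[of _ n n _ m]
    mult_carrier_mat[of _ m n _ n] mult_carrier_mat[of _ m n _ m]
    add_carrier_mat[of _ n n] add_carrier_mat[of _ n m] add_carrier_mat[of _ m n] add_carrier_mat[of _ m m]
  note assoc = assoc_mult_mat[of _ n n _ n _ n] assoc_mult_mat[of _ n n _ n _ m]
    assoc_mult_mat[of _ m n _ n _ n] assoc_mult_mat[of _ m n _ n _ m]
  note dist = mult_add_distrib_mat[of _ m n _ m] mult_add_distrib_mat[of _ m n _ n]
    mult_add_distrib_mat[of _ n n _ m] add_mult_distrib_mat[of _ n n _ _ m]
    add_mult_distrib_mat[of _ m n _ _ n] add_mult_distrib_mat[of _ m n _ _ m]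
  have 12: "D ^\<^sub>m 2 * B\<^sub>0 + ?R\<^sub>2 * B = D ^\<^sub>m 2 * B\<^sub>0 + D * R * B + R * D * B"
    by (simp add: dist carrier assoc_add_mat[of _ n m])
  have 21: "C * ?R\<^sub>2 + C\<^sub>0 * D ^\<^sub>m 2 = C * D * R + C * R * D + C\<^sub>0 * D ^\<^sub>m 2"
    by (simp add: dist carrier assoc)
  have 22: "C * D ^\<^sub>m 3 * B\<^sub>0 + (C * ?R\<^sub>3 + C\<^sub>0 * D ^\<^sub>m 3) * B
    = C * D ^\<^sub>m 3 * B\<^sub>0 + C * D ^\<^sub>m 2 * R * B + C\<^sub>0 * D ^\<^sub>m 3 * B
            + C * D * R * D * B + C * R * D ^\<^sub>m 2 * B"
  proof -
    have "(C * ?R\<^sub>3 + C\<^sub>0 * D ^\<^sub>m 3) * B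
      = C * (D ^\<^sub>m 2 * (R * B)) + C * (D * (R * (D * B))) + C * (R * (D ^\<^sub>m 2 * B))
        + C\<^sub>0 * (D ^\<^sub>m 3 * B)"
      by (simp add: dist carrier assoc)
    then show ?thesis
      using carrier_matD[OF B] carrier_matD[OF C] carrier_matD[OF C\<^sub>0] carrier_matD[OF B\<^sub>0]
      by (intro eq_matI) (simp_all add: assoc carrier del: index_mult_mat(1))
  qed
  have X12: "dual_mat D R ^\<^sub>m 2 * dual_mat B B\<^sub>0
      = dual_mat (D ^\<^sub>m 2 * B) (D ^\<^sub>m 2 * B\<^sub>0 + D * R * B + R * D * B)"
    unfolding dual_mat_power_2_3[OF D R] dual_mat_mult[OF D2 R2 B B\<^sub>0] 12 ..
  have X21: "dual_mat C C\<^sub>0 * dual_mat D R ^\<^sub>m 2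
      = dual_mat (C * D ^\<^sub>m 2) (C * D * R + C * R * D + C\<^sub>0 * D ^\<^sub>m 2)"
    unfolding dual_mat_power_2_3[OF D R] dual_mat_mult[OF C C\<^sub>0 D2 R2] 21 ..
  have X22: "dual_mat C C\<^sub>0 * dual_mat D R ^\<^sub>m 3 * dual_mat B B\<^sub>0
      = dual_mat (C * D ^\<^sub>m 3 * B) (C * D ^\<^sub>m 3 * B\<^sub>0 + C * D ^\<^sub>m 2 * R * B + C\<^sub>0 * D ^\<^sub>m 3 * B
            + C * D * R * D * B + C * R * D ^\<^sub>m 2 * B)"
  proof -
    have "C * ?R\<^sub>3 + C\<^sub>0 * D ^\<^sub>m 3 \<in> carrier_mat m n"
      by (intro add_carrier_mat mult_carrier_mat[OF C\<^sub>0 D3])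
    then show ?thesis
      unfolding dual_mat_power_2_3[OF D R] dual_mat_mult[OF C C\<^sub>0 D3 R3]
      by (simp only: dual_mat_mult[OF mult_carrier_mat[OF C D3] _ B B\<^sub>0] 22)
  qed
  show ?thesis
    unfolding X12 X21 X22
    by (rule four_block_dual_mat[of _ n n _ _ m _ _ m]) (simp_all add: carrier)
qed

theorem theorem4p2:
  fixes n k :: nat and r :: "nat \<Rightarrow> nat"
    and A A\<^sub>0 B B\<^sub>0 C C\<^sub>0 D A\<^sub>R :: "complex mat"
    and x x' y y' :: "nat \<Rightarrow> complex vec"
    and Ah Bh Ch Mh :: "dual_complex mat"
  assumes A: "A \<in> carrier_mat n n" and A\<^sub>0: "A\<^sub>0 \<in> carrier_mat n n"
    and Ah: "Ah = dual_mat A A\<^sub>0"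
    and Ah_DC: "Ah \<in> DC_z n"
    and x: "\<And>i. i < n \<Longrightarrow> x i \<in> carrier_vec (r i) \<and> x' i \<in> carrier_vec (r i)"
    and y: "\<And>i. i < n \<Longrightarrow> y i \<in> carrier_vec (r i) \<and> y' i \<in> carrier_vec (r i)"
    and x_nz: "\<And>i. i < n \<Longrightarrow> dual_vec (x i) (x' i) \<noteq> 0\<^sub>v (r i)"
    and y_nz: "\<And>i. i < n \<Longrightarrow> dual_vec (y i) (y' i) \<noteq> 0\<^sub>v (r i)"
    and Bh: "Bh = diag_block_mat (map (\<lambda>i. mat_of_rows (r i) [dual_vec (x i) (x' i)]) [0..<n])"
    and B: "B = std_mat Bh" and B\<^sub>0: "B\<^sub>0 = inf_mat Bh"
    and Ch: "Ch = diag_block_mat (map (\<lambda>i. mat_of_cols (r i) [dual_vec (y i) (y' i)]) [0..<n])"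
    and C: "C = std_mat Ch" and C\<^sub>0: "C\<^sub>0 = inf_mat Ch"
    and Mh: "Mh = four_block_mat Ah Bh Ch (0\<^sub>m (\<Sum>i<n. r i) (\<Sum>i<n. r i))"
    and Mh_DC: "Mh \<in> DC_z (n + (\<Sum>i<n. r i))"
    and orth: "\<And>i. i < n \<Longrightarrow>
      dual_of (x i \<bullet> y i) + eps * dual_of (x i \<bullet> y' i + x' i \<bullet> y i) = 0"
    and k: "Ind_s Ah = k"
    and D: "D = drazin_inv A"
    and A\<^sub>R: "A\<^sub>R = - (D * A\<^sub>0 * D)
        + msum n (\<lambda>i. D ^\<^sub>m (i + 2) * A\<^sub>0 * A ^\<^sub>m i * (1\<^sub>m n - A * D)) {0..<k}
        + msum n (\<lambda>i. (1\<^sub>m n - A * D) * A ^\<^sub>m i * A\<^sub>0 * D ^\<^sub>m (i + 2)) {0..<k}"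
  shows "drazin_inv (std_mat Mh) =
      four_block_mat
        (D) (D ^\<^sub>m 2 * B)
        (C * D ^\<^sub>m 2) (C * D ^\<^sub>m 3 * B) \<and>
    dual_drazin_inv Mh =
      dual_mat
        (four_block_mat
          (D) (D ^\<^sub>m 2 * B)
          (C * D ^\<^sub>m 2) (C * D ^\<^sub>m 3 * B))
        (four_block_mat
          (A\<^sub>R) (D ^\<^sub>m 2 * B\<^sub>0 + D * A\<^sub>R * B + A\<^sub>R * D * B)
          (C * D * A\<^sub>R + C * A\<^sub>R * D + C\<^sub>0 * D ^\<^sub>m 2)
          (C * D ^\<^sub>m 3 * B\<^sub>0 + C * D ^\<^sub>m 2 * A\<^sub>R * B + C\<^sub>0 * D ^\<^sub>m 3 * B
            + C * D * A\<^sub>R * D * B + C * A\<^sub>R * D ^\<^sub>m 2 * B))"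
proof -
  define m where "m = (\<Sum>i<n. r i)"
  have Bhc: "Bh \<in> carrier_mat n m" and Chc: "Ch \<in> carrier_mat m n"
    unfolding Bh Ch m_def by (rule border_carrier)+
  have Bc: "B \<in> carrier_mat n m" and B\<^sub>0c: "B\<^sub>0 \<in> carrier_mat n m"
    and Cc: "C \<in> carrier_mat m n" and C\<^sub>0c: "C\<^sub>0 \<in> carrier_mat m n"
    unfolding B B\<^sub>0 C C\<^sub>0 using Bhc Chc by simp_all
  have Bh': "Bh = dual_mat B B\<^sub>0" and Ch': "Ch = dual_mat C C\<^sub>0"
    unfolding B B\<^sub>0 C C\<^sub>0 dual_mat_std_inf by (rule refl)+
  have BhCh: "Bh * Ch = 0\<^sub>m n n"
    unfolding Bh Ch
  proof (rule border_mult_eq_zero)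
    fix i assume i: "i < n"
    show "dual_vec (x i) (x' i) \<in> carrier_vec (r i)" "dual_vec (y i) (y' i) \<in> carrier_vec (r i)"
      unfolding dual_vec_def using x[OF i] y[OF i] by simp_all
    show "dual_vec (x i) (x' i) \<bullet> dual_vec (y i) (y' i) = 0"
      using dual_vec_scalar_prod[of "x i" "r i" "x' i" "y i" "y' i"] x[OF i] y[OF i] orth[OF i] by simp
  qed
  \<comment> \<open>The complex relation is the standard part of the dual one.\<close>
  have "B * C = std_mat (0\<^sub>m n n)"
    unfolding B C std_mat_mult[OF Bhc Chc, symmetric] BhCh ..
  then have BC: "B * C = 0\<^sub>m n n"
    unfolding dual_mat_zero[symmetric] std_inf_dual_mat(1)[OF zero_carrier_mat zero_carrier_mat] .
  have Mh': "Mh = dual_mat (four_block_mat A B C (0\<^sub>m m m)) (four_block_mat A\<^sub>0 B\<^sub>0 C\<^sub>0 (0\<^sub>m m m))"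
    unfolding Mh Ah Bh' Ch' m_def[symmetric] dual_mat_zero[of m m, symmetric]
    by (rule four_block_dual_mat[OF A A\<^sub>0 Bc B\<^sub>0c Cc C\<^sub>0c zero_carrier_mat zero_carrier_mat])
  have Mc: "four_block_mat A B C (0\<^sub>m m m) \<in> carrier_mat (n + m) (n + m)"
    and M\<^sub>0c: "four_block_mat A\<^sub>0 B\<^sub>0 C\<^sub>0 (0\<^sub>m m m) \<in> carrier_mat (n + m) (n + m)"
    using four_block_carrier_mat[OF A zero_carrier_mat] four_block_carrier_mat[OF A\<^sub>0 zero_carrier_mat]
    by blast+
  have Ind: "mat_Ind A = k"
    using k unfolding Ind_s_def Ah std_inf_dual_mat(1)[OF A A\<^sub>0] .
  have drazin_D: "is_drazin k A D"
    using is_drazin_drazin_inv[OF A] unfolding Ind D .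
  then have Dc: "D \<in> carrier_mat n n"
    using A unfolding is_drazin_def by simp
  have "is_drazin k (dual_mat A A\<^sub>0) (dual_mat D A\<^sub>R)"
    using is_drazin_dual_DC_z[OF Ah_DC[unfolded Ah] A A\<^sub>0 D] unfolding A\<^sub>R Ind .
  then have drazin_Ah: "is_drazin k Ah (dual_mat D A\<^sub>R)"
    unfolding Ah .
  have Ahc: "Ah \<in> carrier_mat n n"
    unfolding Ah using A A\<^sub>0 by simp
  then have "dual_mat D A\<^sub>R \<in> carrier_mat n n"
    using drazin_Ah unfolding is_drazin_def by simp
  \<comment> \<open>The dimensions of a dual matrix are by \<open>dual_mat_dim\<close> those of its
    infinitesimal part.\<close>
  then have Rc: "A\<^sub>R \<in> carrier_mat n n"
    unfolding carrier_mat_def by simp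
  have "drazin_inv (std_mat Mh) = four_block_mat D (D ^\<^sub>m 2 * B) (C * D ^\<^sub>m 2) (C * D ^\<^sub>m 3 * B)"
    unfolding Mh' std_inf_dual_mat(1)[OF Mc M\<^sub>0c]
    by (rule drazin_inv_eqI[OF Mc is_drazin_bordered[OF A drazin_D Bc Cc BC]])
  \<comment> \<open>The bordered construction is used a second time, now over the ring of dual
    numbers; \<open>Mh_DC\<close> ensures that the dual Drazin inverse of \<open>Mh\<close>
    exists.\<close>
  moreover have "dual_drazin_inv Mh = four_block_mat (dual_mat D A\<^sub>R) (dual_mat D A\<^sub>R ^\<^sub>m 2 * Bh)
      (Ch * dual_mat D A\<^sub>R ^\<^sub>m 2) (Ch * dual_mat D A\<^sub>R ^\<^sub>m 3 * Bh)"
    by (rule dual_drazin_inv_eqI[OF Mh_DC])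
      (unfold Mh m_def[symmetric], rule is_drazin_bordered[OF Ahc drazin_Ah Bhc Chc BhCh])
  ultimately show ?thesis
    unfolding Bh' Ch' four_block_bordered_dual[OF Dc Rc Bc B\<^sub>0c Cc C\<^sub>0c] by blast
qed

end
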